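(* Let $m\ge1$ and define on intervals of $\mathrm{Tam}_n^m$ (via their $m$-interval-posets) $\beta_m=\mathrm{contract}\circ\beta\circ\mathrm{expand}$. Then $\beta_m$ is an involution on the intervals of $\mathrm{Tam}_n^m$ such that for every interval $I$ and every commutative alphabet $X$: $\mathrm{mrises}(I)=\mathrm{mcontacts}(\beta_m(I))$, $\mathrm{mRiseMon}(I,X)=\mathrm{mContactMon}(\beta_m(I),X)$, and $\mathrm{dist}(I)=\mathrm{dist}(\beta_m(I))$.
   Context: $m$-ballot paths of size $n$: lattice paths from $(0,0)$ to $(nm,n)$ with unit vertical/horizontal steps weakly above $y=x/m$. $\mathrm{DD}(B)$ is the Dyck path of size $nm$ replacing each vertical step by $m$ up-steps and each horizontal step by one down-step. $\mathrm{Tam}_n^m$: $B\le B'$ iff $\mathrm{DD}(B)\le\mathrm{DD}(B')$ in the Tamari order on Dyck paths of size $nm$ (equivalently the order generated by $m$-ballot rotations; the images form an upper ideal). $\mathrm{dist}(I)$ for $I=[B_1,B_2]$ is the maximal chain length from $B_1$ to $B_2$ in $\mathrm{Tam}_n^m$. The interval $I=[B_1,B_2]$ corresponds to the interval-poset (defined below) of the Tamari interval $[\mathrm{DD}(B_1),\mathrm{DD}(B_2)]$; these are exactly the $m$-interval-posets: interval-posets of size $nm$ with $im\triangleleft im-1\triangleleft\dots\triangleleft im-(m-1)$ for all $1\le i\le n$. Tamari background: Dyck paths are words in up $1$/down $0$; $\mathrm{tree}(D_1 1 D_2 0)$ has left subtree $\mathrm{tree}(D_1)$, right subtree $\mathrm{tree}(D_2)$;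 Tamari order generated by right rotations $y(x(A,B),C)\to x(A,y(B,C))$; nodes $v_1,\dots,v_N$ in in-order. An interval-poset of size $N$ is a partial order $\triangleleft$ on $\{1,\dots,N\}$ with $a\triangleleft c\Rightarrow b\triangleleft c$ and $c\triangleleft a\Rightarrow b\triangleleft a$ for $a<b<c$; the Tamari interval $[T_1,T_2]$ corresponds to the interval-poset where, for $a<b$, $b\triangleleft a$ iff $v_b$ in right subtree of $v_a$ in $T_1$, $a\triangleleft b$ iff $v_a$ in left subtree of $v_b$ in $T_2$. Grafting trees, $\mathrm{Graft}$, $\beta$: $u$ = interval-poset of size 1. Shifted concatenation of $I_1$ (size $n_1$) and $I_2$: relations of $I_1$ and of $I_2$ shifted by $n_1$. Left grafting $I_1\prec I_2$ ($I_2$ nonempty): add $y\triangleleft n_1+1$ for all $y\le n_1$; $\emptyset\prec I_2=I_2$. Right grafting $I_1\succ_r I_2$ ($I_1$ nonempty, $0\le r\le c$, $y_1<\dots<y_c$ the shifted decreasing roots of $I_2$, i.e. vertices $b$ with no $a<b$, $b\triangleleft a$): add $y_i\triangleleft n_1$ for $i\le r$; $I_1\succ_0\emptyset=I_1$. A grafting tree is a binary tree $T$ with labels $\ell(v)\in\mathbb N$ satisfying $\ell(v)\le\mathrm{size}(T_R(v))-\sum_{w\in T_R(v)}\ell(w)$ for all nodes $v$ ($T_R(v)$ the right subtree). $\mathrm{Graft}^{-1}(\emptyset)=\emptyset$, $\mathrm{Graft}^{-1}(T,\ell)=\mathrm{Graft}^{-1}(T_L,\ell)\prec(u\succ_{\ell(\mathrm{root})}\mathrm{Graft}^{-1}(T_R,\ell))$;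 this is a bijection with inverse $\mathrm{Graft}$. The left branch involution $\mathrm{LB}$ on binary trees: $\mathrm{LB}(\emptyset)=\emptyset$; for $T=v(T_L,T_R)$, $\mathrm{LB}(T)$ is $\mathrm{LB}(T_L)$ with the node $v$ (empty left subtree, right subtree $\mathrm{LB}(T_R)$) attached as left child of its leftmost node (or equal to $v(\emptyset,\mathrm{LB}(T_R))$ if $T_L=\emptyset$); labels travel with nodes; on intervals $\mathrm{LB}(I)=\mathrm{Graft}^{-1}(\mathrm{LB}(\mathrm{Graft}(I)))$. $\mathrm{compl}(I)$: $i\triangleleft j$ iff $(N+1-i)\triangleleft_I(N+1-j)$. $\beta=\mathrm{LB}\circ\mathrm{compl}\circ\mathrm{LB}$. Expansion/contraction: for a grafting tree $(T,\ell)$ of size $nm$, $\mathrm{expand}(T,\ell)=(T,\ell')$ with $\ell'(v_i)=m\ell(v_i)$ if $m\mid i$ and $\ell'(v_i)=m(\ell(v_i)-1)$ otherwise; $\mathrm{contract}(T,\ell')=(T,\ell)$ with $\ell(v_i)=\ell'(v_i)/m$ if $m\mid i$ and $\ell'(v_i)/m+1$ otherwise. These act on interval-posets through $\mathrm{Graft}$. $m$-statistics of an $m$-ballot path $B$: $\mathrm{mcontacts}(B)$ = number of points on $y=x/m$ except the last; $\mathrm{mrises}(B)$ = number of initial vertical steps; for the $i$-th vertical step starting at $(a,b)$ and $1\le j\le m$, $c_{i,j}(B)$ = number of non-final contacts between the line $\ell_{i,j}$ of slope $1/m$ through $(a,b+j/m)$ and the maximal portion of $B$ starting at $(a,b+1)$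 staying weakly above $\ell_{i,j}$; $r_i(B)$ = number of vertical steps immediately after the $i$-th horizontal step. $m$-contact vector $(\mathrm{mcontacts},c_{1,1},\dots,c_{1,m},\dots,c_{n,1},\dots,c_{n,m-1})$, $m$-rise vector $(\mathrm{mrises},r_1,\dots,r_{nm-1})$; $\mathrm{mContactMon}(B,X)$, $\mathrm{mRiseMon}(B,X)$ are the products of $x_v$ over their entries $v$. For $I=[B_1,B_2]$, contact statistics are those of $B_1$, rise statistics those of $B_2$. *)

theory Defs
  imports "HOL-Library.Tree"
begin

section \<open>Dyck paths and the Tamari order\<close>

datatype dyck_step = Up | Down

fun dyck_word :: "unit tree \<Rightarrow> dyck_step list" where
  "dyck_word Leaf = []"
| "dyck_word (Node l x r) = dyck_word l @ [Up] @ dyck_word r @ [Down]"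

text \<open>\<^const>\<open>dyck_word\<close> is a bijection from binary trees to Dyck words, so this is the map
  sending \<open>D\<^sub>1 1 D\<^sub>2 0\<close> to the tree with subtrees \<open>tree(D\<^sub>1)\<close> and \<open>tree(D\<^sub>2)\<close>.\<close>
definition dyck_tree :: "dyck_step list \<Rightarrow> unit tree" where
  "dyck_tree = inv dyck_word"

inductive right_rotation :: "'a tree \<Rightarrow> 'a tree \<Rightarrow> bool" where
  rot_root: "right_rotation (Node (Node A x B) y C) (Node A x (Node B y C))"
| rot_left: "right_rotation A A' \<Longrightarrow> right_rotation (Node A x B) (Node A' x B)"
| rot_right: "right_rotation B B' \<Longrightarrow> right_rotation (Node A x B) (Node A x B')"

definition tamari_le :: "dyck_step list \<Rightarrow> dyck_step list \<Rightarrow> bool" where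
  "tamari_le D D' \<longleftrightarrow> right_rotation\<^sup>*\<^sup>* (dyck_tree D) (dyck_tree D')"

section \<open>Ballot paths and the m-Tamari order\<close>

datatype ballot_step = Vert | Horiz

text \<open>The point \<open>(xpos B k, ypos B k)\<close> is reached by \<open>B\<close> after \<open>k\<close> steps.\<close>
definition xpos :: "ballot_step list \<Rightarrow> nat \<Rightarrow> nat" where
  "xpos B k = count_list (take k B) Horiz"

definition ypos :: "ballot_step list \<Rightarrow> nat \<Rightarrow> nat" where
  "ypos B k = count_list (take k B) Vert"

definition ballot_path :: "nat \<Rightarrow> nat \<Rightarrow> ballot_step list \<Rightarrow> bool" where
  "ballot_path m n B \<longleftrightarrow>
     count_list B Horiz = n * m \<and> count_list B Vert = n \<and>
     (\<forall>k \<le> length B. xpos B k \<le> m * ypos B k)"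

definition DD :: "nat \<Rightarrow> ballot_step list \<Rightarrow> dyck_step list" where
  "DD m B = concat (map (\<lambda>s. case s of Vert \<Rightarrow> replicate m Up | Horiz \<Rightarrow> [Down]) B)"

definition mtam_le :: "nat \<Rightarrow> nat \<Rightarrow> ballot_step list \<Rightarrow> ballot_step list \<Rightarrow> bool" where
  "mtam_le m n B B' \<longleftrightarrow>
     ballot_path m n B \<and> ballot_path m n B' \<and> tamari_le (DD m B) (DD m B')"

definition mtam_less :: "nat \<Rightarrow> nat \<Rightarrow> ballot_step list \<Rightarrow> ballot_step list \<Rightarrow> bool" where
  "mtam_less m n B B' \<longleftrightarrow> mtam_le m n B B' \<and> B \<noteq> B'"

text \<open>An interval \<open>[B\<^sub>1, B\<^sub>2]\<close> is represented by the pair of its bounds.\<close>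
type_synonym interval = "ballot_step list \<times> ballot_step list"

definition mtam_intervals :: "nat \<Rightarrow> nat \<Rightarrow> interval set" where
  "mtam_intervals m n = {(B1, B2). mtam_le m n B1 B2}"

text \<open>The length of a chain is the number of its steps, one less than its number of elements.\<close>
definition mtam_dist :: "nat \<Rightarrow> nat \<Rightarrow> interval \<Rightarrow> nat" where
  "mtam_dist m n I =
     Max {length c - 1 | c. c \<noteq> [] \<and> hd c = fst I \<and> last c = snd I \<and>
                            sorted_wrt (mtam_less m n) c}"

section \<open>Interval-posets\<close>

text \<open>The pair \<open>(N, R)\<close> consists of the size \<open>N\<close> and the (reflexive) order relation \<open>R\<close> on
  \<open>{1..N}\<close>, with \<open>(a, b) \<in> R\<close> for \<open>a \<triangleleft> b\<close>.\<close>
type_synonym iposet = "nat \<times> (nat \<times> nat) set"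

text \<open>\<open>number k T\<close> pairs the label of the \<open>i\<close>-th node of \<open>T\<close> in in-order with \<open>k + i\<close>.\<close>
fun number :: "nat \<Rightarrow> 'a tree \<Rightarrow> (nat \<times> 'a) tree" where
  "number k Leaf = Leaf"
| "number k (Node l x r) =
     Node (number k l) (k + size l + 1, x) (number (k + size l + 1) r)"

text \<open>\<open>v\<^sub>b\<close> lies in the left, respectively right, subtree of \<open>v\<^sub>a\<close> in \<open>T\<close>.\<close>
definition in_left_subtree :: "'a tree \<Rightarrow> nat \<Rightarrow> nat \<Rightarrow> bool" where
  "in_left_subtree T a b \<longleftrightarrow>
     (\<exists>l x r. Node l (a, x) r \<in> subtrees (number 0 T) \<and> b \<in> fst ` set_tree l)"

definition in_right_subtree :: "'a tree \<Rightarrow> nat \<Rightarrow> nat \<Rightarrow> bool" where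
  "in_right_subtree T a b \<longleftrightarrow>
     (\<exists>l x r. Node l (a, x) r \<in> subtrees (number 0 T) \<and> b \<in> fst ` set_tree r)"

definition tamari_iposet :: "nat \<Rightarrow> dyck_step list \<Rightarrow> dyck_step list \<Rightarrow> iposet" where
  "tamari_iposet N D1 D2 =
     (N, Id_on {1..N}
         \<union> {(b, a) | a b. a < b \<and> in_right_subtree (dyck_tree D1) a b}
         \<union> {(a, b) | a b. a < b \<and> in_left_subtree (dyck_tree D2) b a})"

definition mtam_iposet :: "nat \<Rightarrow> nat \<Rightarrow> interval \<Rightarrow> iposet" where
  "mtam_iposet m n I = tamari_iposet (n * m) (DD m (fst I)) (DD m (snd I))"

section \<open>Grafting\<close>

definition shift_concat :: "iposet \<Rightarrow> iposet \<Rightarrow> (nat \<times> nat) set" where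
  "shift_concat I1 I2 = snd I1 \<union> {(fst I1 + a, fst I1 + b) | a b. (a, b) \<in> snd I2}"

text \<open>Adding relations to a poset means taking the order they generate: for instance, a vertex
  below a decreasing root \<open>y\<^sub>i\<close> with \<open>i \<le> r\<close> also becomes a vertex below \<open>n\<^sub>1\<close>.\<close>
definition left_graft :: "iposet \<Rightarrow> iposet \<Rightarrow> iposet" where
  "left_graft I1 I2 =
     (fst I1 + fst I2, (shift_concat I1 I2 \<union> {(y, fst I1 + 1) | y. y \<in> {1..fst I1}})\<^sup>+)"

definition decreasing_roots :: "iposet \<Rightarrow> nat list" where
  "decreasing_roots I = filter (\<lambda>b. \<not> (\<exists>a<b. (b, a) \<in> snd I)) [1..<fst I + 1]"

definition right_graft :: "nat \<Rightarrow> iposet \<Rightarrow> iposet \<Rightarrow> iposet" where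
  "right_graft r I1 I2 =
     (fst I1 + fst I2,
      (shift_concat I1 I2
        \<union> {(fst I1 + y, fst I1) | y. y \<in> set (take r (decreasing_roots I2))})\<^sup>+)"

definition empty_iposet :: iposet where
  "empty_iposet = (0, {})"

definition unit_iposet :: iposet where
  "unit_iposet = (1, {(1, 1)})"

fun grafting_tree :: "nat tree \<Rightarrow> bool" where
  "grafting_tree Leaf \<longleftrightarrow> True"
| "grafting_tree (Node l x r) \<longleftrightarrow>
     grafting_tree l \<and> grafting_tree r \<and> int x \<le> int (size r) - int (sum_list (inorder r))"

fun Graft_inv :: "nat tree \<Rightarrow> iposet" where
  "Graft_inv Leaf = empty_iposet"
| "Graft_inv (Node l x r) =
     left_graft (Graft_inv l) (right_graft x unit_iposet (Graft_inv r))"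

definition Graft :: "iposet \<Rightarrow> nat tree" where
  "Graft = inv_into {T. grafting_tree T} Graft_inv"

section \<open>The involution on Tamari intervals\<close>

text \<open>\<open>attach_leftmost T S\<close> makes \<open>S\<close> the left child of the leftmost node of \<open>T\<close>.\<close>
fun attach_leftmost :: "'a tree \<Rightarrow> 'a tree \<Rightarrow> 'a tree" where
  "attach_leftmost Leaf S = S"
| "attach_leftmost (Node l x r) S = Node (attach_leftmost l S) x r"

fun LB_tree :: "'a tree \<Rightarrow> 'a tree" where
  "LB_tree Leaf = Leaf"
| "LB_tree (Node l x r) = attach_leftmost (LB_tree l) (Node Leaf x (LB_tree r))"

definition LB :: "iposet \<Rightarrow> iposet" where
  "LB I = Graft_inv (LB_tree (Graft I))"

definition compl_iposet :: "iposet \<Rightarrow> iposet" where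
  "compl_iposet I =
     (let N = fst I in
       (N, {(i, j). i \<in> {1..N} \<and> j \<in> {1..N} \<and> (N + 1 - i, N + 1 - j) \<in> snd I}))"

definition beta :: "iposet \<Rightarrow> iposet" where
  "beta = LB \<circ> compl_iposet \<circ> LB"

section \<open>Expansion, contraction and the involution on m-Tamari intervals\<close>

text \<open>In the grafting tree of an m-interval-poset the label of \<open>v\<^sub>i\<close> is positive unless \<open>m\<close>
  divides \<open>i\<close>, so the subtraction below does not truncate.\<close>
definition expand_tree :: "nat \<Rightarrow> nat tree \<Rightarrow> nat tree" where
  "expand_tree m T =
     map_tree (\<lambda>(i, l). if m dvd i then m * l else m * (l - 1)) (number 0 T)"

text \<open>Contraction is only meaningful if \<open>m\<close> divides all labels; rounding quotients are avoided.\<close>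
definition exact_quotient :: "nat \<Rightarrow> nat \<Rightarrow> nat" where
  "exact_quotient l m = (if m dvd l then l div m else undefined)"

definition contract_tree :: "nat \<Rightarrow> nat tree \<Rightarrow> nat tree" where
  "contract_tree m T =
     map_tree (\<lambda>(i, l). if m dvd i then exact_quotient l m else exact_quotient l m + 1)
       (number 0 T)"

definition expand :: "nat \<Rightarrow> iposet \<Rightarrow> iposet" where
  "expand m I = Graft_inv (expand_tree m (Graft I))"

definition contract :: "nat \<Rightarrow> iposet \<Rightarrow> iposet" where
  "contract m I = Graft_inv (contract_tree m (Graft I))"

definition beta_m :: "nat \<Rightarrow> nat \<Rightarrow> interval \<Rightarrow> interval" where
  "beta_m m n I =
     inv_into (mtam_intervals m n) (mtam_iposet m n)
       ((contract m \<circ> beta \<circ> expand m) (mtam_iposet m n I))"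

section \<open>Statistics\<close>

definition mcontacts :: "nat \<Rightarrow> ballot_step list \<Rightarrow> nat" where
  "mcontacts m B = card {k. k < length B \<and> xpos B k = m * ypos B k}"

definition initial_verts :: "ballot_step list \<Rightarrow> nat" where
  "initial_verts B = length (takeWhile (\<lambda>s. s = Vert) B)"

definition mrises :: "ballot_step list \<Rightarrow> nat" where
  "mrises B = initial_verts B"

text \<open>The number of steps of \<open>B\<close> preceding its \<open>i\<close>-th step of kind \<open>s\<close>, where \<open>i \<ge> 1\<close>.\<close>
definition nth_step :: "ballot_step \<Rightarrow> ballot_step list \<Rightarrow> nat \<Rightarrow> nat" where
  "nth_step s B i = filter (\<lambda>k. B ! k = s) [0..<length B] ! (i - 1)"

text \<open>With \<open>k = nth_step Vert B i\<close> and \<open>(a, b) = (xpos B k, ypos B k)\<close>, the line \<open>\<ell>\<^sub>i\<^sub>,\<^sub>j\<close> has the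
  equation \<open>x + j + m b = m y + a\<close>. Since its intersections with steps of the path weakly above
  it are lattice points, it suffices to look at the lattice points of the path.\<close>
definition mcontact :: "nat \<Rightarrow> ballot_step list \<Rightarrow> nat \<Rightarrow> nat \<Rightarrow> nat" where
  "mcontact m B i j =
     (let k = nth_step Vert B i; a = xpos B k; b = ypos B k;
          K = Max {K. k + 1 \<le> K \<and> K \<le> length B \<and>
                      (\<forall>s\<in>{k + 1..K}. xpos B s + j + m * b \<le> m * ypos B s + a)}
      in card {s. k + 1 \<le> s \<and> s < K \<and> xpos B s + j + m * b = m * ypos B s + a})"

definition mrise :: "ballot_step list \<Rightarrow> nat \<Rightarrow> nat" where
  "mrise B i = initial_verts (drop (nth_step Horiz B i + 1) B)"

definition mcontact_vector :: "nat \<Rightarrow> nat \<Rightarrow> ballot_step list \<Rightarrow> nat list" where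
  "mcontact_vector m n B =
     mcontacts m B #
     [mcontact m B i j. i \<leftarrow> [1..<n + 1], j \<leftarrow> [1..<m + 1], (i, j) \<noteq> (n, m)]"

definition mrise_vector :: "nat \<Rightarrow> nat \<Rightarrow> ballot_step list \<Rightarrow> nat list" where
  "mrise_vector m n B = mrises B # [mrise B i. i \<leftarrow> [1..<n * m]]"

definition mContactMon ::
    "nat \<Rightarrow> nat \<Rightarrow> ballot_step list \<Rightarrow> (nat \<Rightarrow> 'a::comm_monoid_mult) \<Rightarrow> 'a" where
  "mContactMon m n B X = prod_list (map X (mcontact_vector m n B))"

definition mRiseMon ::
    "nat \<Rightarrow> nat \<Rightarrow> ballot_step list \<Rightarrow> (nat \<Rightarrow> 'a::comm_monoid_mult) \<Rightarrow> 'a" where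
  "mRiseMon m n B X = prod_list (map X (mrise_vector m n B))"

end

theory Submission
  imports Defs "HOL-Library.Multiset"
begin

text \<open>A grafting tree is a Tamari interval \<open>[S, T]\<close> in disguise: its shape is \<open>T\<close>, and its labels,
  read in in-order, are the numbers of arches enclosed by the up-steps of \<open>S\<close>. The maximal number
  of rotations from \<open>S\<close> to \<open>T\<close> is the total slack of the inequalities defining grafting trees,
  because undoing a rotation at the bottom of an interval increases the slack. Complementation
  reverses all rotations and the left branch involution keeps the slack of each node, hence
  \<open>\<beta>\<close> preserves it.

  The labels of \<open>\<beta>(G)\<close> are, up to order, the lengths of the runs of up-steps in the upper path of
  \<open>G\<close>. Expansion turns the intervals of the m-Tamari order into those Tamari intervals whose runs
  and labels are all multiples of \<open>m\<close>. This set is stable under \<open>\<beta>\<close>, since \<open>\<beta>\<close> is an involution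
  which exchanges runs and labels. Finally, expansion acts on the slack by the affine map
  \<open>d \<mapsto> m d + const\<close>, and the expanded labels are \<open>m\<close> times the entries of the m-contact vector.\<close>

section \<open>Trees as sequences of arches\<close>

text \<open>Complementation crosses the two kinds of data: the new shape comes from the old lower
  tree, the new labels come from the old shape. It is therefore handled through the bounds alone. A
  grafting tree is determined by them, since its labels can be read off the lower tree, and the
  slack has a meaning in terms of them, as the length of a longest chain of rotations. Mirroring and
  exchanging the bounds preserves that length. Runs and labels are exchanged because, after the left
  branch involution and a mirror, the first run becomes the number of outermost arches; both
  multisets then satisfy the same recursion on trees. The additive constants in the slack after
  expansion sum to a number that depends only on \<open>m\<close> and \<open>n\<close> and cancels.
  Longest chains are the same in the m-Tamari order as in the Tamari order, because right rotations
  preserve divisibility of the runs. Finally, runs and labels have one entry more than the two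
  vectors; for \<open>n > 0\<close> the omitted last rise and last contact are both 0.\<close>

text \<open>The nodes of the left spine are the arches, i.e. the prime factors of the Dyck word, and
  the leftmost node is the first one. Hence \<open>attach_leftmost B A\<close> is concatenation,
  with \<open>A\<close> in front.\<close>

fun arches :: "'a tree \<Rightarrow> nat" where
  "arches Leaf = 0"
| "arches (Node l x r) = Suc (arches l)"

fun take_arches :: "nat \<Rightarrow> 'a tree \<Rightarrow> 'a tree" where
  "take_arches k Leaf = Leaf"
| "take_arches k (Node l x r) = (if arches l < k then Node l x r else take_arches k l)"

fun drop_arches :: "nat \<Rightarrow> 'a tree \<Rightarrow> 'a tree" where
  "drop_arches k Leaf = Leaf"
| "drop_arches k (Node l x r) = (if arches l < k then Leaf else Node (drop_arches k l) x r)"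

lemma attach_leftmost_Leaf [simp]: "attach_leftmost T Leaf = T"
  by (induction T) auto

lemma attach_leftmost_assoc:
  "attach_leftmost (attach_leftmost C B) A = attach_leftmost C (attach_leftmost B A)"
  by (induction C) auto

lemma size_attach_leftmost [simp]: "size (attach_leftmost B A) = size A + size B"
  by (induction B) auto

lemma arches_attach_leftmost [simp]: "arches (attach_leftmost B A) = arches A + arches B"
  by (induction B) auto

lemma dyck_word_attach_leftmost [simp]:
  "dyck_word (attach_leftmost B A) = dyck_word A @ dyck_word B"
  by (induction B) auto

lemma arches_eq_0_iff [simp]: "arches T = 0 \<longleftrightarrow> T = Leaf"
  by (cases T) auto

lemma take_arches_all: "arches T \<le> k \<Longrightarrow> take_arches k T = T"
  by (cases T) auto

lemma drop_arches_all: "arches T \<le> k \<Longrightarrow> drop_arches k T = Leaf"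
  by (cases T) auto

lemma attach_drop_take_arches [simp]:
  "attach_leftmost (drop_arches k T) (take_arches k T) = T"
  by (induction T) auto

lemma take_arches_attach: "take_arches (arches A) (attach_leftmost B A) = A"
  by (induction B) (auto simp: take_arches_all)

lemma drop_arches_attach: "drop_arches (arches A) (attach_leftmost B A) = B"
  by (induction B) (auto simp: drop_arches_all)

lemma arches_take_arches [simp]: "arches (take_arches k T) = min k (arches T)"
  by (induction T) auto

lemma arches_drop_arches [simp]: "arches (drop_arches k T) = arches T - k"
  by (induction T) auto

section \<open>Grafting trees and Tamari intervals\<close>

abbreviation shape :: "'a tree \<Rightarrow> unit tree" where
  "shape \<equiv> map_tree (\<lambda>_. ())"

text \<open>A grafting tree \<open>G\<close> encodes the Tamari interval \<open>[lower_tree G, shape G]\<close>: the label of a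
  node is the number of arches enclosed by the corresponding up-step of the lower path.\<close>
fun lower_tree :: "nat tree \<Rightarrow> unit tree" where
  "lower_tree Leaf = Leaf"
| "lower_tree (Node l x r) =
     attach_leftmost (drop_arches x (lower_tree r))
       (Node (lower_tree l) () (take_arches x (lower_tree r)))"

fun slack :: "nat tree \<Rightarrow> nat" where
  "slack Leaf = 0"
| "slack (Node l x r) = slack l + slack r + (arches (lower_tree r) - x)"

lemma size_lower_tree [simp]: "size (lower_tree G) = size G"
proof (induction G)
  case (Node l x r)
  have "size (take_arches x (lower_tree r)) + size (drop_arches x (lower_tree r)) = size r"
    by (metis Node.IH(2) attach_drop_take_arches size_attach_leftmost)
  then show ?case using Node by simp
qed simp

text \<open>Every node opens one arch and hides as many arches under it as its label says. The bound
  in \<open>grafting_tree\<close> is thus the number of arches available in the right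
  subtree.\<close>

lemma arches_lower_tree:
  "grafting_tree G \<Longrightarrow> arches (lower_tree G) + sum_list (inorder G) = size G"
  by (induction G) auto

lemma grafting_tree_Node_iff:
  "grafting_tree (Node l x r) \<longleftrightarrow>
     grafting_tree l \<and> grafting_tree r \<and> x \<le> arches (lower_tree r)"
  using arches_lower_tree[of r] by auto

section \<open>Longest chains of rotations inside an interval\<close>

lemma relpowp_map:
  assumes "(R ^^ k) x y" and "\<And>x y. R x y \<Longrightarrow> R' (f x) (f y)"
  shows "(R' ^^ k) (f x) (f y)"
  using assms(1)
proof (induction k arbitrary: y)
  case (Suc k)
  then obtain z where "(R ^^ k) x z" "R z y" by auto
  with Suc.IH assms(2) show ?case by auto
qed simp

lemma relpowp_trans: "(R ^^ j) x y \<Longrightarrow> (R ^^ k) y z \<Longrightarrow> (R ^^ (j + k)) x z"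
  by (auto simp: relpowp_add)

lemma right_rotation_attach_first:
  "right_rotation A A' \<Longrightarrow> right_rotation (attach_leftmost B A) (attach_leftmost B A')"
  by (induction B) (auto intro: right_rotation.intros)

lemma right_rotation_attach_second:
  "right_rotation B B' \<Longrightarrow> right_rotation (attach_leftmost B A) (attach_leftmost B' A)"
  by (induction rule: right_rotation.induct) (auto intro: right_rotation.intros)

text \<open>One rotation per arch: each lets the node \<open>x\<close> enclose the next arch to its
  right.\<close>

lemma right_rotation_absorb_arches:
  "(right_rotation ^^ arches B) (attach_leftmost B (Node L x A)) (Node L x (attach_leftmost B A))"
proof (induction B)
  case (Node b1 y b2)
  have "(right_rotation ^^ arches b1) (Node (attach_leftmost b1 (Node L x A)) y b2)
      (Node (Node L x (attach_leftmost b1 A)) y b2)"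
    by (rule relpowp_map[OF Node.IH(1), where f = "\<lambda>t. Node t y b2"]) (rule rot_left)
  then show ?case by (auto intro: rot_root)
qed simp

lemma rotations_lower_to_shape:
  "grafting_tree G \<Longrightarrow> (right_rotation ^^ slack G) (lower_tree G) (shape G)"
proof (induction G)
  case (Node l x r)
  define A where "A = take_arches x (lower_tree r)"
  define B where "B = drop_arches x (lower_tree r)"
  have AB: "attach_leftmost B A = lower_tree r" by (simp add: A_def B_def)
  have gl: "grafting_tree l" "grafting_tree r" using Node.prems by auto
  have "(right_rotation ^^ slack l) (attach_leftmost B (Node (lower_tree l) () A))
          (attach_leftmost B (Node (shape l) () A))"
    by (rule relpowp_map[OF Node.IH(1)[OF gl(1)]])
      (intro right_rotation_attach_first rot_left)
  \<comment> \<open>Absorbing \<open>B\<close> precedes the rotations in the right subtree: it makes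
    \<open>lower_tree r\<close> whole again, which is where the induction hypothesis for
    \<open>r\<close> starts.\<close>
  moreover have "(right_rotation ^^ arches B) (attach_leftmost B (Node (shape l) () A))
          (Node (shape l) () (lower_tree r))"
    using right_rotation_absorb_arches[of B "shape l" "()" A] AB by simp
  moreover have "(right_rotation ^^ slack r) (Node (shape l) () (lower_tree r))
          (Node (shape l) () (shape r))"
    by (rule relpowp_map[OF Node.IH(2)[OF gl(2)]]) (rule rot_right)
  ultimately have "(right_rotation ^^ (slack l + (arches B + slack r)))
      (attach_leftmost B (Node (lower_tree l) () A)) (Node (shape l) () (shape r))"
    by (blast intro: relpowp_trans)
  moreover have "slack l + (arches B + slack r) = slack (Node l x r)"
    by (simp add: B_def)
  ultimately show ?case by (simp add: A_def B_def add_ac)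
qed simp

text \<open>A rotation pushes an arch under an up-step, so the arch it changes lies in a single
  factor of the result. Only the target of a rotation can be split like this: starting from a
  concatenation, a rotation may merge the last arch of \<open>X\<close> with the first arch of
  \<open>Y\<close>.\<close>

lemma right_rotation_attach_cases:
  assumes "right_rotation S (attach_leftmost Y X)"
  obtains X' where "S = attach_leftmost Y X'" "right_rotation X' X"
  | Y' where "S = attach_leftmost Y' X" "right_rotation Y' Y"
proof -
  have "(\<exists>X'. S = attach_leftmost Y X' \<and> right_rotation X' X) \<or>
        (\<exists>Y'. S = attach_leftmost Y' X \<and> right_rotation Y' Y)"
    using assms
  proof (induction Y arbitrary: S)
    case (Node Y1 y Y2)
    from Node.prems have "right_rotation S (Node (attach_leftmost Y1 X) y Y2)" by simp
    then show ?case
    proof (cases rule: right_rotation.cases)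
      case (rot_root B z C)
      then have "S = attach_leftmost (Node (Node Y1 y B) z C) X" by simp
      moreover have "right_rotation (Node (Node Y1 y B) z C) (Node Y1 y Y2)"
        using rot_root(2) by (simp add: right_rotation.rot_root)
      ultimately show ?thesis by blast
    next
      case (rot_left A)
      from Node.IH(1)[OF rot_left(2)] show ?thesis
        using rot_left(1) by (auto intro: right_rotation.rot_left)
          (metis attach_leftmost.simps(2) right_rotation.rot_left)
    next
      case (rot_right B)
      then show ?thesis
        by (metis attach_leftmost.simps(2) right_rotation.rot_right)
    qed
  qed auto
  then show thesis using that by blast
qed

lemma right_rotation_arches: "right_rotation S T \<Longrightarrow> arches T \<le> arches S"
  by (induction rule: right_rotation.induct) auto

lemma right_rotation_size: "right_rotation S T \<Longrightarrow> size T = size S"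
  by (induction rule: right_rotation.induct) auto

text \<open>Backwards, a rotation releases an arch. Either the root releases its last one, or the
  change is internal to \<open>lower_tree l\<close> or \<open>lower_tree r\<close>; in the latter
  case the released arch may land outside the root, so the slack can grow by more than one.\<close>

lemma grafting_tree_unrotate:
  assumes "grafting_tree G" "right_rotation S (lower_tree G)"
  shows "\<exists>G'. grafting_tree G' \<and> lower_tree G' = S \<and> shape G' = shape G \<and> slack G < slack G'"
  using assms
proof (induction G arbitrary: S)
  case Leaf
  then show ?case by (auto elim: right_rotation.cases)
next
  case (Node l x r)
  define A where "A = take_arches x (lower_tree r)"
  define B where "B = drop_arches x (lower_tree r)"
  have AB: "attach_leftmost B A = lower_tree r" by (simp add: A_def B_def)
  have g: "grafting_tree l" "grafting_tree r" "x \<le> arches (lower_tree r)"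
    using Node.prems(1) grafting_tree_Node_iff by blast+
  have xA: "x = arches A" using g by (simp add: A_def)
  have slack_G: "slack (Node l x r) = slack l + slack r + arches B"
    by (simp add: B_def)
  \<comment> \<open>Any way of cutting \<open>lower_tree r'\<close> into \<open>A'\<close> followed
    by \<open>B'\<close> is realised by the label \<open>arches A'\<close>.\<close>
  have build: "grafting_tree (Node l' (arches A') r') \<and>
      lower_tree (Node l' (arches A') r') = attach_leftmost B' (Node (lower_tree l') () A') \<and>
      slack (Node l' (arches A') r') = slack l' + slack r' + arches B'"
    if "grafting_tree l'" "grafting_tree r'" "lower_tree r' = attach_leftmost B' A'"
    for l' r' A' B'
    unfolding grafting_tree_Node_iff using that
    by (simp add: take_arches_attach drop_arches_attach)
  from Node.prems(2)
  have "right_rotation S (attach_leftmost B (Node (lower_tree l) () A))"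
    by (simp add: A_def B_def)
  then show ?case
  proof (cases rule: right_rotation_attach_cases)
    case (1 X')
    from 1(2) show ?thesis
    proof (cases rule: right_rotation.cases)
      \<comment> \<open>The last arch of \<open>A = Node C y D\<close> leaves the root and becomes
        the first arch of the outer part.\<close>
      case (rot_root C y D)
      have "lower_tree r = attach_leftmost (attach_leftmost B (Node Leaf () D)) C"
        using AB rot_root by (simp add: attach_leftmost_assoc)
      from build[OF g(1,2) this] show ?thesis
        using 1 rot_root slack_G
        by (intro exI[of _ "Node l (arches C) r"]) (simp add: attach_leftmost_assoc)
    next
      case (rot_left L)
      from Node.IH(1)[OF g(1) rot_left(2)] obtain l' where l':
        "grafting_tree l'" "lower_tree l' = L" "shape l' = shape l" "slack l < slack l'" by blast
      from build[OF l'(1) g(2) AB[symmetric]] show ?thesis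
        using 1 rot_left l' slack_G
        by (intro exI[of _ "Node l' (arches A) r"]) simp
    next
      case (rot_right A')
      have "right_rotation (attach_leftmost B A') (lower_tree r)"
        using right_rotation_attach_first[OF rot_right(2), of B] AB by simp
      from Node.IH(2)[OF g(2) this] obtain r' where r':
        "grafting_tree r'" "lower_tree r' = attach_leftmost B A'" "shape r' = shape r"
        "slack r < slack r'" by blast
      from build[OF g(1) r'(1,2)] show ?thesis
        using 1 rot_right r' slack_G
        by (intro exI[of _ "Node l (arches A') r'"]) simp
    qed
  next
    case (2 B')
    have "right_rotation (attach_leftmost B' A) (lower_tree r)"
      using right_rotation_attach_second[OF 2(2), of A] AB by simp
    from Node.IH(2)[OF g(2) this] obtain r' where r':
      "grafting_tree r'" "lower_tree r' = attach_leftmost B' A" "shape r' = shape r"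
      "slack r < slack r'" by blast
    from build[OF g(1) r'(1,2)] right_rotation_arches[OF 2(2)] show ?thesis
      using 2 r' slack_G
      by (intro exI[of _ "Node l (arches A) r'"]) simp
  qed
qed

text \<open>All labels are as large as allowed, so nothing is moved out of a right subtree: this
  encodes the interval \<open>[T, T]\<close>.\<close>

fun degree_tree :: "'a tree \<Rightarrow> nat tree" where
  "degree_tree Leaf = Leaf"
| "degree_tree (Node l x r) = Node (degree_tree l) (arches r) (degree_tree r)"

lemma degree_tree_trivial_interval:
  fixes T :: "unit tree"
  shows "lower_tree (degree_tree T) = T" "shape (degree_tree T) = T"
    "grafting_tree (degree_tree T)"
proof -
  show *: "lower_tree (degree_tree T) = T" for T :: "unit tree"
    by (induction T) (auto simp: take_arches_all drop_arches_all)
  show "shape (degree_tree T) = T" by (induction T) auto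
  show "grafting_tree (degree_tree T)"
    by (induction T) (auto simp: grafting_tree_Node_iff * simp del: grafting_tree.simps(2))
qed

text \<open>The rotations are undone one by one, starting from \<open>[T, T]\<close>. This yields
  the encoding of the interval and the bound on the chain length together.\<close>

lemma grafting_tree_of_rotations:
  assumes "(right_rotation ^^ k) S T"
  shows "\<exists>G. grafting_tree G \<and> lower_tree G = S \<and> shape G = T \<and> k \<le> slack G"
  using assms
proof (induction k arbitrary: S)
  case 0
  then show ?case using degree_tree_trivial_interval[of T] by auto
next
  case (Suc k)
  from relpowp_Suc_D2[OF Suc.prems] obtain S' where
    S': "right_rotation S S'" "(right_rotation ^^ k) S' T" by blast
  from Suc.IH[OF S'(2)] obtain G where
    G: "grafting_tree G" "lower_tree G = S'" "shape G = T" "k \<le> slack G" by blast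
  from grafting_tree_unrotate[OF G(1)] S'(1) G show ?case by fastforce
qed

section \<open>The labels of a grafting tree\<close>

fun degrees :: "'a tree \<Rightarrow> nat list" where
  "degrees Leaf = []"
| "degrees (Node l x r) = degrees l @ arches r # degrees r"

lemma length_degrees [simp]: "length (degrees T) = size T"
  by (induction T) auto

lemma degrees_attach_leftmost [simp]:
  "degrees (attach_leftmost B A) = degrees A @ degrees B"
  by (induction B) auto

lemma inorder_eq_degrees_lower_tree: "grafting_tree G \<Longrightarrow> inorder G = degrees (lower_tree G)"
proof (induction G)
  case (Node l x r)
  then have "x \<le> arches (lower_tree r)" by (simp add: grafting_tree_Node_iff del: grafting_tree.simps)
  moreover have "degrees (take_arches x (lower_tree r)) @ degrees (drop_arches x (lower_tree r))
    = degrees (lower_tree r)"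
    by (metis attach_drop_take_arches degrees_attach_leftmost)
  ultimately show ?case using Node by simp
qed simp

lemma tree_eqI_shape_inorder:
  "shape S = shape T \<Longrightarrow> inorder S = inorder T \<Longrightarrow> S = T"
proof (induction S arbitrary: T)
  case (Node l x r)
  then obtain l' x' r' where T: "T = Node l' x' r'" by (cases T) auto
  with Node.prems have sh: "shape l = shape l'" "shape r = shape r'" by auto
  then have "size l = size l'" by (metis size_map_tree)
  then have len: "length (inorder l) = length (inorder l')" by simp
  have "inorder l @ x # inorder r = inorder l' @ x' # inorder r'"
    using Node.prems(2) T by simp
  from append_eq_append_conv[THEN iffD1, OF disjI1[OF len] this]
  have "inorder l = inorder l'" "x = x'" "inorder r = inorder r'" by simp_all
  with Node.IH sh T show ?case by metis
qed auto

text \<open>The lower tree gives the labels in in-order, the shape gives their places.\<close>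

lemma grafting_tree_eqI:
  assumes "grafting_tree G" "grafting_tree H" "lower_tree G = lower_tree H" "shape G = shape H"
  shows "G = H"
  using assms by (metis tree_eqI_shape_inorder inorder_eq_degrees_lower_tree)

lemma rotations_le_slack:
  assumes "grafting_tree G" "(right_rotation ^^ k) (lower_tree G) (shape G)"
  shows "k \<le> slack G"
  using grafting_tree_of_rotations[OF assms(2)] grafting_tree_eqI assms(1) by metis

section \<open>Interval-posets of grafting trees\<close>

text \<open>The pairs \<open>(b, a)\<close> such that the node numbered \<open>b\<close> lies in the right, respectively left,
  subtree of the node numbered \<open>a\<close>, where the in-order numbering starts at \<open>k + 1\<close>.\<close>
fun right_pairs :: "nat \<Rightarrow> 'a tree \<Rightarrow> (nat \<times> nat) set" where
  "right_pairs k Leaf = {}"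
| "right_pairs k (Node l x r) =
     right_pairs k l \<union> {k + size l + 2..k + size l + 1 + size r} \<times> {k + size l + 1}
       \<union> right_pairs (k + size l + 1) r"

fun left_pairs :: "nat \<Rightarrow> 'a tree \<Rightarrow> (nat \<times> nat) set" where
  "left_pairs k Leaf = {}"
| "left_pairs k (Node l x r) =
     left_pairs k l \<union> {k + 1..k + size l} \<times> {k + size l + 1} \<union> left_pairs (k + size l + 1) r"

lemma right_pairs_range:
  "(b, a) \<in> right_pairs k T \<Longrightarrow> k < a \<and> a < b \<and> b \<le> k + size T"
  by (induction k T rule: right_pairs.induct) fastforce+

lemma left_pairs_range:
  "(a, b) \<in> left_pairs k T \<Longrightarrow> k < a \<and> a < b \<and> b \<le> k + size T"
  by (induction k T rule: left_pairs.induct) fastforce+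

lemma right_pairs_attach_leftmost:
  "right_pairs k (attach_leftmost B A) = right_pairs k A \<union> right_pairs (k + size A) B"
  by (induction B) (simp_all add: add.assoc Un_assoc)

lemma right_pairs_shift:
  "{(c + a, c + b) | a b. (a, b) \<in> right_pairs k T} = right_pairs (c + k) T"
proof (induction k T rule: right_pairs.induct)
  case (2 k l x r)
  have *: "{(c + a, c + b) | a b. (a, b) \<in> A \<times> {d}} = ((+) c ` A) \<times> {c + d}" for A d
    by auto
  have "{(c + a, c + b) | a b. (a, b) \<in> right_pairs k (Node l x r)} =
      {(c + a, c + b) | a b. (a, b) \<in> right_pairs k l} \<union>
      {(c + a, c + b) | a b. (a, b) \<in> {k + size l + 2..k + size l + 1 + size r} \<times> {k + size l + 1}} \<union>
      {(c + a, c + b) | a b. (a, b) \<in> right_pairs (k + size l + 1) r}"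
    unfolding right_pairs.simps by blast
  then show ?case unfolding 2 * image_add_atLeastAtMost by (simp add: add_ac)
qed simp

lemma left_pairs_shift:
  "{(c + a, c + b) | a b. (a, b) \<in> left_pairs k T} = left_pairs (c + k) T"
proof (induction k T rule: left_pairs.induct)
  case (2 k l x r)
  have *: "{(c + a, c + b) | a b. (a, b) \<in> A \<times> {d}} = ((+) c ` A) \<times> {c + d}" for A d
    by auto
  have "{(c + a, c + b) | a b. (a, b) \<in> left_pairs k (Node l x r)} =
      {(c + a, c + b) | a b. (a, b) \<in> left_pairs k l} \<union>
      {(c + a, c + b) | a b. (a, b) \<in> {k + 1..k + size l} \<times> {k + size l + 1}} \<union>
      {(c + a, c + b) | a b. (a, b) \<in> left_pairs (k + size l + 1) r}"
    unfolding left_pairs.simps by blast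
  then show ?case unfolding 2 * image_add_atLeastAtMost by (simp add: add_ac)
qed simp

text \<open>Reflection at \<open>s\<close> maps the numbers from \<open>k + 1\<close> on to those
  from \<open>k' + 1\<close> on. The offsets are independent because the two subtrees shift them
  differently; the guards exclude truncated subtraction.\<close>

lemma left_pairs_mirror:
  "s = k + k' + size T + 1 \<Longrightarrow>
   (a, b) \<in> left_pairs k T \<longleftrightarrow> a \<le> s \<and> b \<le> s \<and> (s - a, s - b) \<in> right_pairs k' (mirror T)"
proof (induction T arbitrary: k k')
  case (Node l x r)
  have "(a, b) \<in> left_pairs k l \<longleftrightarrow>
      a \<le> s \<and> b \<le> s \<and> (s - a, s - b) \<in> right_pairs (k' + size r + 1) (mirror l)"
    using Node.prems by (intro Node.IH(1)) simp
  moreover have "(a, b) \<in> left_pairs (k + size l + 1) r \<longleftrightarrow>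
      a \<le> s \<and> b \<le> s \<and> (s - a, s - b) \<in> right_pairs k' (mirror r)"
    using Node.prems by (intro Node.IH(2)) simp
  moreover have "(a, b) \<in> {k + 1..k + size l} \<times> {k + size l + 1} \<longleftrightarrow> a \<le> s \<and> b \<le> s \<and>
      (s - a, s - b) \<in> {k' + size r + 2..k' + size r + 1 + size l} \<times> {k' + size r + 1}"
    using Node.prems by auto
  ultimately show ?case unfolding left_pairs.simps mirror.simps right_pairs.simps size_mirror
    by blast
qed simp

text \<open>The position of the root is determined: of two different candidates, the later one would
  be a descendant of the earlier one in one tree, but is the root of the other.\<close>

lemma right_pairs_inject:
  fixes S T :: "unit tree"
  assumes "size S = size T" "right_pairs k S = right_pairs k T"
  shows "S = T"
  using assms
proof (induction S arbitrary: k T)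
  case (Node l x r)
  then obtain l' x' r' where T: "T = Node l' x' r'" by (cases T) auto
  have size: "size l + size r = size l' + size r'" using Node.prems T by simp
  have not_less: "\<not> size u < size u'"
    if eq: "right_pairs k (Node u y v) = right_pairs k (Node u' y' v')"
      and s: "size u + size v = size u' + size v'"
    for u u' v v' :: "unit tree" and y y'
  proof
    assume less: "size u < size u'"
    have "(k + size u' + 1, k + size u + 1) \<in> right_pairs k (Node u y v)"
      using less s by simp
    then have "(k + size u' + 1, k + size u + 1) \<in> right_pairs k (Node u' y' v')"
      by (simp only: eq)
    then show False by (auto dest: right_pairs_range)
  qed
  have eq: "right_pairs k (Node l x r) = right_pairs k (Node l' x' r')"
    using Node.prems T by simp
  have sl: "size l = size l'"
    using not_less[OF eq size] not_less[OF eq[symmetric] size[symmetric]] by simp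
  then have sr: "size r = size r'" using size by simp
  have restr_l: "right_pairs k u = {(b, a) \<in> right_pairs k (Node u y v). b \<le> k + size u}"
    for u v :: "unit tree" and y
    by (auto dest: right_pairs_range)
  have restr_r: "right_pairs (k + size u + 1) v
      = {(b, a) \<in> right_pairs k (Node u y v). k + size u + 1 < a}"
    for u v :: "unit tree" and y
    by (auto dest: right_pairs_range)
  have "right_pairs k l = right_pairs k l'"
    using restr_l[of l x r] restr_l[of l' x' r'] eq sl by (simp only:)
  moreover have "right_pairs (k + size l + 1) r = right_pairs (k + size l + 1) r'"
    using restr_r[of l r x] restr_r[of l' r' x'] eq sl by (simp only:)
  ultimately show ?case using Node.IH sl sr T by simp
qed simp

lemma left_pairs_inject:
  fixes S T :: "unit tree"
  assumes "size S = size T" "left_pairs 0 S = left_pairs 0 T"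
  shows "S = T"
proof -
  have "right_pairs 0 (mirror T) \<subseteq> right_pairs 0 (mirror S)"
    if "size S = size T" "left_pairs 0 S = left_pairs 0 T" for S T :: "unit tree"
  proof (clarify)
    fix a b assume ab: "(b, a) \<in> right_pairs 0 (mirror T)"
    let ?s = "0 + 0 + size T + 1"
    from right_pairs_range[OF ab] have le: "a \<le> ?s" "b \<le> ?s" by auto
    with ab have "(?s - b, ?s - a) \<in> left_pairs 0 T"
      by (subst left_pairs_mirror[of ?s 0 0]) auto
    with that have "(?s - b, ?s - a) \<in> left_pairs 0 S" by simp
    with left_pairs_mirror[of ?s 0 0 S "?s - b" "?s - a"] that(1) le
    show "(b, a) \<in> right_pairs 0 (mirror S)" by simp
  qed
  from this[OF assms] this[OF assms[symmetric]]
  have "right_pairs 0 (mirror S) = right_pairs 0 (mirror T)" by auto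
  then have "mirror S = mirror T"
    using right_pairs_inject[of "mirror S" "mirror T"] assms(1) by simp
  then show ?thesis by (metis mirror_mirror)
qed

section \<open>The relation of an interval and the graftings\<close>

definition interval_rel :: "nat \<Rightarrow> unit tree \<Rightarrow> unit tree \<Rightarrow> (nat \<times> nat) set" where
  "interval_rel k S T = Id_on {k + 1..k + size T} \<union> right_pairs k S \<union> left_pairs k T"

abbreviation graft_rel :: "nat \<Rightarrow> nat tree \<Rightarrow> (nat \<times> nat) set" where
  "graft_rel k G \<equiv> interval_rel k (lower_tree G) (shape G)"

lemma interval_rel_range:
  assumes "(a, b) \<in> interval_rel k S T" "size S = size T"
  shows "k < a" "a \<le> k + size T" "k < b" "b \<le> k + size T"
  using assms by (auto simp: interval_rel_def dest: right_pairs_range left_pairs_range)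

lemma interval_rel_decreasing:
  assumes "a < b"
  shows "(b, a) \<in> interval_rel k S T \<longleftrightarrow> (b, a) \<in> right_pairs k S"
  using assms by (auto simp: interval_rel_def dest: right_pairs_range left_pairs_range)

lemma interval_rel_inject:
  assumes "interval_rel 0 S T = interval_rel 0 S' T'"
    and "size S = size S'" "size T = size T'"
  shows "S = S'" "T = T'"
proof -
  have restr_right: "right_pairs 0 S = {(b, a) \<in> interval_rel 0 S T. a < b}" for S T
    by (auto simp: interval_rel_def dest: right_pairs_range left_pairs_range)
  have "right_pairs 0 S = right_pairs 0 S'"
    using restr_right[of S T] restr_right[of S' T'] assms(1) by simp
  then show "S = S'" using assms(2) right_pairs_inject by blast
  have restr_left: "left_pairs 0 T = {(a, b) \<in> interval_rel 0 S T. a < b}" for S T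
    by (auto simp: interval_rel_def dest: right_pairs_range left_pairs_range)
  have "left_pairs 0 T = left_pairs 0 T'"
    using restr_left[of T S] restr_left[of T' S'] assms(1) by simp
  then show "T = T'" using assms(3) left_pairs_inject by blast
qed

lemma interval_rel_shift:
  "{(c + a, c + b) | a b. (a, b) \<in> interval_rel k S T} = interval_rel (c + k) S T"
proof -
  have "{(c + a, c + b) | a b. (a, b) \<in> Id_on A} = Id_on ((+) c ` A)" for A
    by auto
  then have "{(c + a, c + b) | a b. (a, b) \<in> Id_on {k + 1..k + size T}}
      = Id_on {c + k + 1..c + k + size T}"
    by (simp add: add_ac)
  moreover have "{(c + a, c + b) | a b. (a, b) \<in> interval_rel k S T} =
      {(c + a, c + b) | a b. (a, b) \<in> Id_on {k + 1..k + size T}} \<union>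
      {(c + a, c + b) | a b. (a, b) \<in> right_pairs k S} \<union>
      {(c + a, c + b) | a b. (a, b) \<in> left_pairs k T}"
    unfolding interval_rel_def by blast
  ultimately show ?thesis
    by (simp only: right_pairs_shift left_pairs_shift interval_rel_def add.assoc)
qed

text \<open>Moving arches out from under the root does not affect the relations within
  \<open>r\<close>, since the right pairs of a concatenation are the union of those of its factors.
  Only the pairs ending in the root \<open>c\<close> see the label.\<close>

lemma graft_rel_Node:
  assumes "c = k + size l + 1"
  shows "graft_rel k (Node l x r) =
    graft_rel k l \<union> {k + 1..k + size l} \<times> {c} \<union> {(c, c)} \<union>
    {c + 1..c + size (take_arches x (lower_tree r))} \<times> {c} \<union> graft_rel c r"
proof -
  define A where "A = take_arches x (lower_tree r)"
  define B where "B = drop_arches x (lower_tree r)"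
  have AB: "attach_leftmost B A = lower_tree r" by (simp add: A_def B_def)
  have "right_pairs k (lower_tree (Node l x r)) = right_pairs k (lower_tree l) \<union>
      {c + 1..c + size A} \<times> {c} \<union> (right_pairs c A \<union> right_pairs (c + size A) B)"
    by (simp add: A_def[symmetric] B_def[symmetric] right_pairs_attach_leftmost assms add_ac
        Un_assoc)
  also have "right_pairs c A \<union> right_pairs (c + size A) B = right_pairs c (lower_tree r)"
    by (simp add: AB[symmetric] right_pairs_attach_leftmost)
  finally have 1: "right_pairs k (lower_tree (Node l x r)) = right_pairs k (lower_tree l) \<union>
      {c + 1..c + size A} \<times> {c} \<union> right_pairs c (lower_tree r)" .
  have 2: "left_pairs k (shape (Node l x r)) =
      left_pairs k (shape l) \<union> {k + 1..k + size l} \<times> {c} \<union> left_pairs c (shape r)"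
    by (simp add: assms)
  have "{k + 1..k + size (Node l x r)} = {k + 1..k + size l} \<union> {c} \<union> {c + 1..c + size r}"
    using assms by auto
  then have 3: "Id_on {k + 1..k + size (shape (Node l x r))} =
      Id_on {k + 1..k + size (shape l)} \<union> {(c, c)} \<union> Id_on {c + 1..c + size (shape r)}"
    unfolding size_map_tree by auto
  show ?thesis unfolding interval_rel_def 1 2 3 A_def[symmetric] by blast
qed

text \<open>Both graftings take a transitive closure; this shows that it adds nothing beyond the
  relation of the interval.\<close>

lemma trans_graft_rel: "trans (graft_rel k G)"
proof (induction G arbitrary: k)
  case Leaf
  show ?case by (simp add: interval_rel_def)
next
  case (Node l x r)
  define c where "c = k + size l + 1"
  define A where "A = take_arches x (lower_tree r)"
  define B where "B = drop_arches x (lower_tree r)"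
  have AB: "attach_leftmost B A = lower_tree r" by (simp add: A_def B_def)
  \<comment> \<open>The vertices of the first \<open>x\<close> arches are closed downwards: going to
    larger numbers stays inside an arch, going to smaller ones stays among the first arches.\<close>
  have down: "z' \<in> {c + 1..c + size A}"
    if "(z', z) \<in> graft_rel c r" "z \<in> {c + 1..c + size A}" for z z'
  proof (cases "z < z'")
    case True
    with that have "(z', z) \<in> right_pairs c (attach_leftmost B A)"
      by (simp add: AB interval_rel_decreasing)
    with that(2) show ?thesis
      by (auto simp: right_pairs_attach_leftmost dest: right_pairs_range)
  next
    case False
    with that interval_rel_range[OF that(1)] show ?thesis by auto
  qed
  have ran_l: "k < a \<and> a < c \<and> k < b \<and> b < c" if "(a, b) \<in> graft_rel k l" for a b
    using interval_rel_range[OF that] by (simp add: c_def)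
  have ran_r: "c < a \<and> c < b" if "(a, b) \<in> graft_rel c r" for a b
    using interval_rel_range[OF that] by simp
  have eq: "graft_rel k (Node l x r) = graft_rel k l \<union> {k + 1..<c} \<times> {c} \<union> {(c, c)} \<union>
    {c + 1..c + size A} \<times> {c} \<union> graft_rel c r"
    using graft_rel_Node[OF c_def] by (simp add: A_def c_def atLeastLessThanSuc_atLeastAtMost)
  show ?case unfolding eq
  proof (rule transI)
    fix a b d
    let ?R = "graft_rel k l \<union> {k + 1..<c} \<times> {c} \<union> {(c, c)} \<union>
      {c + 1..c + size A} \<times> {c} \<union> graft_rel c r"
    assume ab: "(a, b) \<in> ?R" and bd: "(b, d) \<in> ?R"
    consider "b < c" | "b = c" | "c < b" by linarith
    then show "(a, d) \<in> ?R"
    proof cases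
      case 1
      with ab have ab': "(a, b) \<in> graft_rel k l" by (auto dest: ran_r)
      from bd 1 consider "(b, d) \<in> graft_rel k l" | "d = c" by (auto dest: ran_r)
      then show ?thesis using ab' transD[OF Node.IH(1)] ran_l[OF ab'] by cases auto
    next
      case 2
      with bd have "d = c" by (auto dest: ran_r ran_l)
      with ab 2 show ?thesis by blast
    next
      case 3
      with ab have ab': "(a, b) \<in> graft_rel c r" by (auto dest: ran_l)
      from bd 3 consider "(b, d) \<in> graft_rel c r" | "d = c" "b \<in> {c + 1..c + size A}"
        by (auto dest: ran_l)
      then show ?thesis using ab' transD[OF Node.IH(2)] down[OF ab'] by cases auto
    qed
  qed
qed

text \<open>These are the decreasing roots: a node on the left spine lies in no right
  subtree.\<close>

fun arch_starts :: "nat \<Rightarrow> 'a tree \<Rightarrow> nat list" where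
  "arch_starts k Leaf = []"
| "arch_starts k (Node l x r) = arch_starts k l @ [k + size l + 1]"

lemma length_arch_starts [simp]: "length (arch_starts k T) = arches T"
  by (induction T) auto

lemma take_arch_starts: "take j (arch_starts k T) = arch_starts k (take_arches j T)"
proof (induction T)
  case (Node l x r)
  show ?case
  proof (cases "arches l < j")
    case False
    then show ?thesis using Node by simp
  qed simp
qed simp

lemma filter_arch_starts:
  "filter (\<lambda>b. \<nexists>a. (b, a) \<in> right_pairs k T) [k + 1..<k + size T + 1] = arch_starts k T"
proof (induction T)
  case (Node l x r)
  let ?P = "\<lambda>b. \<nexists>a. (b, a) \<in> right_pairs k (Node l x r)"
  let ?c = "k + size l + 1"
  have upt: "[k + 1..<k + size (Node l x r) + 1] = [k + 1..<?c] @ ?c # [?c + 1..<?c + 1 + size r]"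
    using upt_add_eq_append[of "k + 1" ?c "1 + size r"] upt_conv_Cons[of ?c "?c + (1 + size r)"]
    by (simp add: add_ac)
  have left: "filter ?P [k + 1..<?c] = arch_starts k l"
  proof -
    have "filter ?P [k + 1..<?c] = filter (\<lambda>b. \<nexists>a. (b, a) \<in> right_pairs k l) [k + 1..<?c]"
      by (intro filter_cong) (auto dest: right_pairs_range)
    then show ?thesis using Node.IH(1) by (simp only:)
  qed
  have right: "filter ?P [?c + 1..<?c + 1 + size r] = []"
    by (auto simp: filter_empty_conv intro!: exI[of _ ?c])
  have root: "?P ?c" by (auto dest: right_pairs_range)
  show ?case unfolding upt filter_append left filter.simps right if_P[OF root] arch_starts.simps ..
qed simp

text \<open>Right grafting adds relations for decreasing roots only; through this lemma the closure
  supplies them for all vertices of the chosen arches.\<close>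

lemma arch_starts_cover:
  assumes "z \<in> {k + 1..k + size T}"
  shows "z \<in> set (arch_starts k T) \<or> (\<exists>y \<in> set (arch_starts k T). (z, y) \<in> right_pairs k T)"
  using assms
proof (induction T)
  case (Node l x r)
  consider "z \<in> {k + 1..k + size l}" | "z = k + size l + 1"
    | "z \<in> {k + size l + 2..k + size l + 1 + size r}"
    using Node.prems by fastforce
  then show ?case by cases (use Node.IH(1) in auto)
qed simp

definition graft_iposet :: "nat tree \<Rightarrow> iposet" where
  "graft_iposet G = (size G, graft_rel 0 G)"

lemma fst_graft_iposet [simp]: "fst (graft_iposet G) = size G"
  by (simp add: graft_iposet_def)

lemma decreasing_roots_graft_iposet:
  "decreasing_roots (graft_iposet G) = arch_starts 0 (lower_tree G)"
proof -
  have "filter (\<lambda>b. \<nexists>a. a < b \<and> (b, a) \<in> graft_rel 0 G) [1..<size G + 1] =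
      filter (\<lambda>b. \<nexists>a. (b, a) \<in> right_pairs 0 (lower_tree G)) [0 + 1..<0 + size (lower_tree G) + 1]"
    by (intro filter_cong) (auto simp: interval_rel_decreasing dest: right_pairs_range)
  then show ?thesis
    unfolding filter_arch_starts by (simp add: decreasing_roots_def graft_iposet_def)
qed

lemma right_graft_graft_iposet:
  "right_graft x unit_iposet (graft_iposet r) = graft_iposet (Node Leaf x r)"
proof -
  define A where "A = take_arches x (lower_tree r)"
  define R where "R = {(1, 1)} \<union> graft_rel 1 r \<union> {(1 + y, 1) | y. y \<in> set (arch_starts 0 A)}"
  have rel: "graft_rel 0 (Node Leaf x r) =
      {(1, 1)} \<union> {2..1 + size A} \<times> {1} \<union> graft_rel 1 r"
    using graft_rel_Node[of 1 0 Leaf x r]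
    by (simp add: A_def interval_rel_def numeral_2_eq_2 del: lower_tree.simps(2))
  have "shift_concat unit_iposet (graft_iposet r) = {(1, 1)} \<union> graft_rel 1 r"
    using interval_rel_shift[of 1 0 "lower_tree r" "shape r"]
    by (simp add: shift_concat_def unit_iposet_def graft_iposet_def)
  then have "right_graft x unit_iposet (graft_iposet r) = (1 + size r, R\<^sup>+)"
    by (simp add: right_graft_def decreasing_roots_graft_iposet take_arch_starts R_def A_def
        unit_iposet_def)
  moreover have "R\<^sup>+ = graft_rel 0 (Node Leaf x r)"
  proof
    have "y \<in> {1..size A}" if "y \<in> set (arch_starts 0 A)" for y
    proof -
      have "y \<in> set (filter (\<lambda>b. \<nexists>a. (b, a) \<in> right_pairs 0 A) [0 + 1..<0 + size A + 1])"
        using that by (simp only: filter_arch_starts)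
      then show ?thesis by auto
    qed
    then have "R \<subseteq> graft_rel 0 (Node Leaf x r)" unfolding R_def rel by fastforce
    then show "R\<^sup>+ \<subseteq> graft_rel 0 (Node Leaf x r)"
      by (metis trans_graft_rel trancl_id trancl_mono subrelI)
    \<comment> \<open>Two steps of \<open>R\<close> suffice: from \<open>z\<close> to the start of
      its arch, and from there to the new vertex 1.\<close>
    have "(z, 1) \<in> R\<^sup>+" if "z \<in> {2..1 + size A}" for z
    proof -
      have "z - 1 \<in> {0 + 1..0 + size A}" using that by auto
      from arch_starts_cover[OF this] consider "z - 1 \<in> set (arch_starts 0 A)"
        | y where "y \<in> set (arch_starts 0 A)" "(z - 1, y) \<in> right_pairs 0 A" by blast
      then show ?thesis
      proof cases
        case 1
        then have "(1 + (z - 1), 1) \<in> R" unfolding R_def by blast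
        then show ?thesis using that by auto
      next
        case 2
        have "right_pairs 0 A \<subseteq> right_pairs 0 (lower_tree r)"
          using right_pairs_attach_leftmost[of 0 "drop_arches x (lower_tree r)" A]
          by (simp add: A_def)
        with 2 have "(1 + (z - 1), 1 + y) \<in> {(1 + a, 1 + b) | a b. (a, b) \<in> right_pairs 0 (lower_tree r)}"
          by blast
        then have "(1 + (z - 1), 1 + y) \<in> right_pairs 1 (lower_tree r)"
          by (simp only: right_pairs_shift add_0_right)
        then have "(z, 1 + y) \<in> R" using that unfolding R_def interval_rel_def by simp
        moreover have "(1 + y, 1) \<in> R" using 2 unfolding R_def by blast
        ultimately show ?thesis by (meson trancl.simps)
      qed
    qed
    then show "graft_rel 0 (Node Leaf x r) \<subseteq> R\<^sup>+"
      unfolding rel by (auto simp: R_def)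
  qed
  ultimately show ?thesis by (simp add: graft_iposet_def)
qed

lemma left_graft_graft_iposet:
  "left_graft (graft_iposet l) (graft_iposet (Node Leaf x r)) = graft_iposet (Node l x r)"
proof -
  let ?c = "size l + 1"
  let ?A = "take_arches x (lower_tree r)"
  have "graft_rel (size l) (Node Leaf x r) =
      {(?c, ?c)} \<union> {?c + 1..?c + size ?A} \<times> {?c} \<union> graft_rel ?c r"
    using graft_rel_Node[of ?c "size l" Leaf x r]
    by (simp add: interval_rel_def del: lower_tree.simps(2))
  moreover have "graft_rel 0 (Node l x r) =
      graft_rel 0 l \<union> {1..size l} \<times> {?c} \<union> {(?c, ?c)} \<union> {?c + 1..?c + size ?A} \<times> {?c} \<union> graft_rel ?c r"
    using graft_rel_Node[of ?c 0 l x r] by simp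
  moreover have "shift_concat (graft_iposet l) (graft_iposet (Node Leaf x r)) =
      graft_rel 0 l \<union> graft_rel (size l) (Node Leaf x r)"
    using interval_rel_shift[of "size l" 0 "lower_tree (Node Leaf x r)" "shape (Node Leaf x r)"]
    by (simp only: shift_concat_def graft_iposet_def fst_conv snd_conv add_0_right)
  moreover have "{(y, ?c) | y. y \<in> {1..size l}} = {1..size l} \<times> {?c}" by auto
  ultimately have "shift_concat (graft_iposet l) (graft_iposet (Node Leaf x r)) \<union>
      {(y, ?c) | y. y \<in> {1..size l}} = graft_rel 0 (Node l x r)"
    by (simp only:) blast
  then show ?thesis
    by (simp only: left_graft_def graft_iposet_def fst_conv trancl_id[OF trans_graft_rel]) simp
qed

text \<open>This ties the recursive grafting to the Tamari interval
  \<open>[lower_tree G, shape G]\<close>.\<close>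

lemma Graft_inv_eq_graft_iposet: "Graft_inv G = graft_iposet G"
  by (induction G)
    (simp add: graft_iposet_def empty_iposet_def interval_rel_def,
     simp only: Graft_inv.simps right_graft_graft_iposet left_graft_graft_iposet)

lemma inj_on_Graft_inv: "inj_on Graft_inv {G. grafting_tree G}"
proof (rule inj_onI)
  fix G H assume *: "G \<in> {G. grafting_tree G}" "H \<in> {G. grafting_tree G}" "Graft_inv G = Graft_inv H"
  then have "size G = size H" "graft_rel 0 G = graft_rel 0 H"
    by (simp_all add: Graft_inv_eq_graft_iposet graft_iposet_def)
  with interval_rel_inject[OF this(2)] * show "G = H"
    by (intro grafting_tree_eqI) auto
qed

lemma Graft_Graft_inv: "grafting_tree G \<Longrightarrow> Graft (Graft_inv G) = G"
  unfolding Graft_def by (rule inv_into_f_f[OF inj_on_Graft_inv]) simp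

lemma fst_set_tree_number: "fst ` set_tree (number k T) = {k + 1..k + size T}"
proof (induction k T rule: number.induct)
  case (2 k l x r)
  then show ?case by (simp only: number.simps tree.set image_Un image_insert fst_conv) auto
qed simp

lemma in_right_subtree_iff: "in_right_subtree T a b \<longleftrightarrow> (b, a) \<in> right_pairs 0 T"
proof -
  have "(\<exists>l x r. Node l (a, x) r \<in> subtrees (number k T) \<and> b \<in> fst ` set_tree r) \<longleftrightarrow>
      (b, a) \<in> right_pairs k T" for k
  proof (induction k T rule: number.induct)
    case (2 k l x r)
    have "(\<exists>l' x' r'. Node l' (a, x') r' \<in> subtrees (number k (Node l x r)) \<and> b \<in> fst ` set_tree r') \<longleftrightarrow>
       a = k + size l + 1 \<and> b \<in> fst ` set_tree (number (k + size l + 1) r) \<or>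
       (\<exists>l' x' r'. Node l' (a, x') r' \<in> subtrees (number k l) \<and> b \<in> fst ` set_tree r') \<or>
       (\<exists>l' x' r'. Node l' (a, x') r' \<in> subtrees (number (k + size l + 1) r) \<and> b \<in> fst ` set_tree r')"
      unfolding number.simps subtrees.simps by blast
    then show ?case unfolding 2 fst_set_tree_number by auto
  qed simp
  then show ?thesis unfolding in_right_subtree_def by blast
qed

lemma in_left_subtree_iff: "in_left_subtree T a b \<longleftrightarrow> (b, a) \<in> left_pairs 0 T"
proof -
  have "(\<exists>l x r. Node l (a, x) r \<in> subtrees (number k T) \<and> b \<in> fst ` set_tree l) \<longleftrightarrow>
      (b, a) \<in> left_pairs k T" for k
  proof (induction k T rule: number.induct)
    case (2 k l x r)
    have "(\<exists>l' x' r'. Node l' (a, x') r' \<in> subtrees (number k (Node l x r)) \<and> b \<in> fst ` set_tree l') \<longleftrightarrow>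
       a = k + size l + 1 \<and> b \<in> fst ` set_tree (number k l) \<or>
       (\<exists>l' x' r'. Node l' (a, x') r' \<in> subtrees (number k l) \<and> b \<in> fst ` set_tree l') \<or>
       (\<exists>l' x' r'. Node l' (a, x') r' \<in> subtrees (number (k + size l + 1) r) \<and> b \<in> fst ` set_tree l')"
      unfolding number.simps subtrees.simps by blast
    then show ?case unfolding 2 fst_set_tree_number by auto
  qed simp
  then show ?thesis unfolding in_left_subtree_def by blast
qed

lemma tamari_iposet_eq:
  assumes "size (dyck_tree D2) = N"
  shows "tamari_iposet N D1 D2 = (N, interval_rel 0 (dyck_tree D1) (dyck_tree D2))"
  using assms
  by (auto simp: tamari_iposet_def interval_rel_def in_right_subtree_iff in_left_subtree_iff
      dest: right_pairs_range left_pairs_range)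

section \<open>Complementation and the left branch involution\<close>

lemma right_rotation_mirror: "right_rotation S T \<Longrightarrow> right_rotation (mirror T) (mirror S)"
  by (induction rule: right_rotation.induct) (auto intro: right_rotation.intros)

lemma rotations_mirror:
  "(right_rotation ^^ k) S T \<Longrightarrow> (right_rotation ^^ k) (mirror T) (mirror S)"
proof (induction k arbitrary: T)
  case (Suc k)
  then obtain U where "(right_rotation ^^ k) S U" "right_rotation U T" by auto
  with Suc.IH show ?case by (meson relpowp_Suc_I2 right_rotation_mirror)
qed simp

text \<open>Reversing the numbering exchanges increasing and decreasing relations, hence left
  subtrees of the upper tree and right subtrees of the lower one.\<close>

lemma compl_graft_iposet:
  assumes "shape H = mirror (lower_tree G)" "lower_tree H = mirror (shape G)"
  shows "compl_iposet (graft_iposet G) = graft_iposet H"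
proof -
  have N: "size H = size G" by (metis assms(1) size_lower_tree size_map_tree size_mirror)
  let ?N = "size G"
  have "(i, j) \<in> graft_rel 0 H \<longleftrightarrow>
      i \<in> {1..?N} \<and> j \<in> {1..?N} \<and> (?N + 1 - i, ?N + 1 - j) \<in> graft_rel 0 G" for i j
  proof (cases "i \<in> {1..?N} \<and> j \<in> {1..?N}")
    case True
    have 1: "(i, j) \<in> left_pairs 0 (mirror (lower_tree G)) \<longleftrightarrow>
        (?N + 1 - i, ?N + 1 - j) \<in> right_pairs 0 (lower_tree G)"
      using True left_pairs_mirror[of "?N + 1" 0 0 "mirror (lower_tree G)" i j] by auto
    have 2: "(?N + 1 - i, ?N + 1 - j) \<in> left_pairs 0 (shape G) \<longleftrightarrow>
        (i, j) \<in> right_pairs 0 (mirror (shape G))"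
      using True left_pairs_mirror[of "?N + 1" 0 0 "shape G" "?N + 1 - i" "?N + 1 - j"] by auto
    have 3: "(i, j) \<in> Id_on {0 + 1..0 + size (mirror (lower_tree G))} \<longleftrightarrow>
        (?N + 1 - i, ?N + 1 - j) \<in> Id_on {0 + 1..0 + size (shape G)}"
      using True by (auto simp: Id_on_iff)
    show ?thesis unfolding interval_rel_def assms Un_iff 1 2 3 using True by blast
  next
    case False
    then show ?thesis using interval_rel_range[of i j 0 "lower_tree H" "shape H"] N by auto
  qed
  then have "graft_rel 0 H = {(i, j). i \<in> {1..?N} \<and> j \<in> {1..?N} \<and>
      (?N + 1 - i, ?N + 1 - j) \<in> graft_rel 0 G}"
    by auto
  then show ?thesis by (simp add: compl_iposet_def graft_iposet_def N Let_def)
qed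

text \<open>The choice is unique by \<open>grafting_tree_eqI\<close>, because it prescribes both
  bounds.\<close>

definition compl_tree :: "nat tree \<Rightarrow> nat tree" where
  "compl_tree G = (SOME H. grafting_tree H \<and> lower_tree H = mirror (shape G) \<and>
     shape H = mirror (lower_tree G) \<and> slack H = slack G)"

lemma compl_tree:
  assumes "grafting_tree G"
  shows "grafting_tree (compl_tree G)" "lower_tree (compl_tree G) = mirror (shape G)"
    "shape (compl_tree G) = mirror (lower_tree G)" "slack (compl_tree G) = slack G"
proof -
  have "(right_rotation ^^ slack G) (mirror (shape G)) (mirror (lower_tree G))"
    by (rule rotations_mirror[OF rotations_lower_to_shape[OF assms]])
  from grafting_tree_of_rotations[OF this] obtain H where
    H: "grafting_tree H" "lower_tree H = mirror (shape G)" "shape H = mirror (lower_tree G)"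
      "slack G \<le> slack H" by blast
  \<comment> \<open>Mirroring back turns a longest chain for \<open>H\<close> into a chain for
    \<open>G\<close>, which gives the reverse inequality of slacks.\<close>
  from rotations_mirror[OF rotations_lower_to_shape[OF H(1)]]
  have "(right_rotation ^^ slack H) (lower_tree G) (shape G)" by (simp add: H)
  with rotations_le_slack[OF assms] H(4) have "slack H = slack G" by fastforce
  with H have "\<exists>H. grafting_tree H \<and> lower_tree H = mirror (shape G) \<and>
     shape H = mirror (lower_tree G) \<and> slack H = slack G" by blast
  from someI_ex[OF this] show "grafting_tree (compl_tree G)"
    "lower_tree (compl_tree G) = mirror (shape G)"
    "shape (compl_tree G) = mirror (lower_tree G)" "slack (compl_tree G) = slack G"
    unfolding compl_tree_def by blast+
qed

lemma compl_tree_involution: "grafting_tree G \<Longrightarrow> compl_tree (compl_tree G) = G"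
  by (rule grafting_tree_eqI) (simp_all add: compl_tree)

lemma compl_Graft_inv:
  "grafting_tree G \<Longrightarrow> compl_iposet (Graft_inv G) = Graft_inv (compl_tree G)"
  by (simp add: Graft_inv_eq_graft_iposet compl_graft_iposet compl_tree)

text \<open>The left branch involution reverses the sequence of arches at every nesting level, so it
  reverses concatenations.\<close>

lemma LB_tree_attach_leftmost:
  "LB_tree (attach_leftmost B A) = attach_leftmost (LB_tree A) (LB_tree B)"
  by (induction B) (auto simp: attach_leftmost_assoc)

lemma LB_tree_involution: "LB_tree (LB_tree T) = T"
  by (induction T) (auto simp: LB_tree_attach_leftmost)

lemma mset_inorder_attach_leftmost:
  "mset (inorder (attach_leftmost B A)) = mset (inorder A) + mset (inorder B)"
  by (induction B) auto

lemma mset_inorder_LB_tree: "mset (inorder (LB_tree T)) = mset (inorder T)"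
  by (induction T) (auto simp: mset_inorder_attach_leftmost)

lemma sum_list_inorder_LB_tree:
  "sum_list (inorder (LB_tree G)) = sum_list (inorder (G :: nat tree))"
  by (metis mset_inorder_LB_tree sum_mset_sum_list[symmetric])

lemma size_LB_tree [simp]: "size (LB_tree T) = size T"
  by (induction T) auto

lemma shape_LB_tree: "shape (LB_tree T) = LB_tree (shape T)"
proof -
  have "shape (attach_leftmost B A) = attach_leftmost (shape B) (shape A)" for A B :: "'a tree"
    by (induction B) auto
  then show ?thesis by (induction T) auto
qed

lemma grafting_tree_attach_leftmost:
  "grafting_tree (attach_leftmost B A) \<longleftrightarrow> grafting_tree A \<and> grafting_tree B"
  by (induction B) auto

lemma grafting_tree_LB_tree: "grafting_tree (LB_tree G) \<longleftrightarrow> grafting_tree G"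
  by (induction G) (auto simp: grafting_tree_attach_leftmost sum_list_inorder_LB_tree)

text \<open>The number of arches is the size minus the sum of the labels, and both are
  invariant.\<close>

lemma arches_lower_tree_LB_tree:
  assumes "grafting_tree G"
  shows "arches (lower_tree (LB_tree G)) = arches (lower_tree G)"
  using arches_lower_tree[of G] arches_lower_tree[of "LB_tree G"] assms
  by (simp add: grafting_tree_LB_tree sum_list_inorder_LB_tree)

lemma slack_LB_tree: "grafting_tree G \<Longrightarrow> slack (LB_tree G) = slack G"
proof -
  have "slack (attach_leftmost B A) = slack A + slack B" for A B
    by (induction B) auto
  then show "grafting_tree G \<Longrightarrow> slack (LB_tree G) = slack G"
    by (induction G) (auto simp: arches_lower_tree_LB_tree)
qed

section \<open>The involution on grafting trees\<close>

definition beta_tree :: "nat tree \<Rightarrow> nat tree" where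
  "beta_tree G = LB_tree (compl_tree (LB_tree G))"

lemma grafting_tree_beta_tree: "grafting_tree G \<Longrightarrow> grafting_tree (beta_tree G)"
  by (simp add: beta_tree_def grafting_tree_LB_tree compl_tree)

lemma beta_Graft_inv: "grafting_tree G \<Longrightarrow> beta (Graft_inv G) = Graft_inv (beta_tree G)"
  by (simp add: beta_def LB_def Graft_Graft_inv compl_Graft_inv grafting_tree_LB_tree compl_tree
      beta_tree_def)

lemma beta_tree_involution: "grafting_tree G \<Longrightarrow> beta_tree (beta_tree G) = G"
  by (simp add: beta_tree_def LB_tree_involution compl_tree_involution grafting_tree_LB_tree)

lemma slack_beta_tree: "grafting_tree G \<Longrightarrow> slack (beta_tree G) = slack G"
  by (simp add: beta_tree_def slack_LB_tree compl_tree grafting_tree_LB_tree)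

lemma size_beta_tree: "grafting_tree G \<Longrightarrow> size (beta_tree G) = size G"
  by (metis beta_tree_def compl_tree(3) grafting_tree_LB_tree size_LB_tree size_lower_tree
      size_map_tree size_mirror)

section \<open>Rises and contacts\<close>

text \<open>Empty runs of up-steps are recorded: there is one entry more than there are down-steps.\<close>
fun runs :: "dyck_step list \<Rightarrow> nat list" where
  "runs [] = [0]"
| "runs (Up # w) = Suc (hd (runs w)) # tl (runs w)"
| "runs (Down # w) = 0 # runs w"

lemma runs_not_Nil [simp]: "runs w \<noteq> []"
  by (cases w rule: runs.cases) auto

lemma runs_append:
  "runs (v @ w) = butlast (runs v) @ (last (runs v) + hd (runs w)) # tl (runs w)"
proof (induction v rule: runs.induct)
  case 1
  show ?case by (cases "runs w") auto
next
  case (2 v)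
  show ?case using 2 runs_not_Nil[of v] by (cases "runs v") auto
next
  case (3 v)
  then show ?case by auto
qed

text \<open>The leftmost node of \<open>B\<close> has degree 0 in the mirror; hanging
  \<open>A\<close> below it turns this 0 into \<open>arches (mirror A)\<close>. The added 0 stands
  for the one that disappears.\<close>

lemma degrees_mirror_attach_leftmost:
  "B \<noteq> Leaf \<Longrightarrow> add_mset 0 (mset (degrees (mirror (attach_leftmost B A)))) =
     mset (degrees (mirror B)) + add_mset (arches (mirror A)) (mset (degrees (mirror A)))"
  "B \<noteq> Leaf \<Longrightarrow> arches (mirror (attach_leftmost B A)) = arches (mirror B)"
proof -
  show arches: "B \<noteq> Leaf \<Longrightarrow> arches (mirror (attach_leftmost B A)) = arches (mirror B)" for B
    by (cases B) auto
  show "B \<noteq> Leaf \<Longrightarrow> add_mset 0 (mset (degrees (mirror (attach_leftmost B A)))) =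
     mset (degrees (mirror B)) + add_mset (arches (mirror A)) (mset (degrees (mirror A)))"
  proof (induction B)
    case (Node b1 y b2)
    show ?case
    proof (cases "b1 = Leaf")
      case False
      with Node.IH(1) arches[of b1] show ?thesis by simp
    qed simp
  qed simp
qed

lemma runs_snoc_Down: "runs (w @ [Down]) = runs w @ [0]"
  using append_butlast_last_id[of "runs w"] by (simp add: runs_append)

lemma last_runs_dyck_word: "last (runs (dyck_word T)) = 0"
proof (cases T)
  case (Node l x r)
  then have "dyck_word T = (dyck_word l @ Up # dyck_word r) @ [Down]" by simp
  then show ?thesis by (simp only: runs_snoc_Down last_snoc)
qed simp

text \<open>The final empty run of the left word merges with the run that begins at the root, and
  the last down-step creates a new empty run. The form with a 0 on both sides fits
  \<open>degrees_mirror_attach_leftmost\<close>.\<close>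

lemma runs_dyck_word_Node:
  "mset (runs (dyck_word (Node l x r))) + {#0#} =
     mset (runs (dyck_word l)) + mset (Suc (hd (runs (dyck_word r))) # tl (runs (dyck_word r))) + {#0#}"
  "hd (runs (dyck_word (Node l x r))) =
     (if l = Leaf then Suc (hd (runs (dyck_word r))) else hd (runs (dyck_word l)))"
proof -
  have Up: "runs (Up # dyck_word r @ [Down]) =
      Suc (hd (runs (dyck_word r))) # tl (runs (dyck_word r)) @ [0]"
    by (simp add: runs_snoc_Down)
  have eq: "runs (dyck_word (Node l x r)) = butlast (runs (dyck_word l)) @
      Suc (hd (runs (dyck_word r))) # tl (runs (dyck_word r)) @ [0]"
    unfolding dyck_word.simps append.simps
    by (subst runs_append) (simp add: Up last_runs_dyck_word del: runs.simps)
  have l: "butlast (runs (dyck_word l)) @ [0] = runs (dyck_word l)"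
    using append_butlast_last_id[OF runs_not_Nil, of "dyck_word l"]
    by (simp only: last_runs_dyck_word)
  have "mset (runs (dyck_word l)) = add_mset 0 (mset (butlast (runs (dyck_word l))))"
    by (subst l[symmetric]) simp
  with eq show "mset (runs (dyck_word (Node l x r))) + {#0#} =
     mset (runs (dyck_word l)) + mset (Suc (hd (runs (dyck_word r))) # tl (runs (dyck_word r))) + {#0#}"
    by simp
  show "hd (runs (dyck_word (Node l x r))) =
     (if l = Leaf then Suc (hd (runs (dyck_word r))) else hd (runs (dyck_word l)))"
  proof (cases l)
    case (Node l1 y l2)
    have "length (runs (dyck_word l)) > 1"
      unfolding Node by (simp add: runs_append)
    then have ne: "butlast (runs (dyck_word l)) \<noteq> []" by (cases "runs (dyck_word l)") auto
    have "hd (runs (dyck_word (Node l x r))) = hd (butlast (runs (dyck_word l)))"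
      unfolding eq by (rule hd_append2[OF ne])
    also have "\<dots> = hd (runs (dyck_word l))"
      using hd_append2[OF ne, of "[0]"] unfolding l by (rule sym)
    finally show ?thesis using Node by simp
  qed (simp add: runs_snoc_Down)
qed

text \<open>Both sides follow the same recursion: the root lengthens the first run of
  \<open>r\<close> by one, and the result replaces a 0 in the list for \<open>l\<close>. The first
  run is tracked separately because it is the one that is lengthened.\<close>

lemma runs_eq_degrees_LB_tree:
  "hd (runs (dyck_word T)) = arches (mirror (LB_tree T)) \<and>
   mset (runs (dyck_word T)) =
     add_mset (arches (mirror (LB_tree T))) (mset (degrees (mirror (LB_tree T))))"
proof (induction T)
  case (Node l x r)
  let ?a = "arches (mirror (LB_tree r))" and ?R = "Node Leaf x (LB_tree r)"
  have "mset (runs (dyck_word r)) = add_mset ?a (mset (tl (runs (dyck_word r))))"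
    using conjunct1[OF Node.IH(2)] by (cases "runs (dyck_word r)") simp_all
  then have tl: "mset (tl (runs (dyck_word r))) = mset (degrees (mirror (LB_tree r)))"
    using Node.IH(2) by simp
  have sum: "mset (runs (dyck_word (Node l x r))) + {#0#} =
     mset (runs (dyck_word l)) + add_mset (Suc ?a) (mset (degrees (mirror (LB_tree r)))) + {#0#}"
    using runs_dyck_word_Node(1)[of l x r] tl Node.IH(2) by simp
  show ?case
  proof (cases "l = Leaf")
    case True
    with sum runs_dyck_word_Node(2)[of l x r] Node.IH(2) show ?thesis by simp
  next
    case False
    then have ne: "LB_tree l \<noteq> Leaf" by (metis size_LB_tree eq_size_0)
    note D = degrees_mirror_attach_leftmost[OF ne, of ?R]
    have hd: "hd (runs (dyck_word (Node l x r))) = arches (mirror (LB_tree (Node l x r)))"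
      using runs_dyck_word_Node(2)[of l x r] Node.IH(1) False D(2) by simp
    have "add_mset 0 (mset (runs (dyck_word (Node l x r)))) =
       add_mset 0 (add_mset (arches (mirror (LB_tree (Node l x r))))
         (mset (degrees (mirror (LB_tree (Node l x r))))))"
      using sum Node.IH(1) D by (simp add: add_mset_commute)
    with hd show ?thesis by simp
  qed
qed simp

text \<open>The outer \<open>LB_tree\<close> only permutes labels, and those of a complement are the
  degrees of its lower tree, here \<open>mirror (LB_tree (shape G))\<close>.\<close>

lemma runs_eq_labels_beta_tree:
  assumes "grafting_tree G"
  shows "hd (runs (dyck_word (shape G))) = arches (lower_tree (beta_tree G))"
    and "mset (runs (dyck_word (shape G))) =
      add_mset (arches (lower_tree (beta_tree G))) (mset (inorder (beta_tree G)))"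
proof -
  have g: "grafting_tree (LB_tree G)" using assms by (simp add: grafting_tree_LB_tree)
  have low: "lower_tree (compl_tree (LB_tree G)) = mirror (LB_tree (shape G))"
    using compl_tree(2)[OF g] by (simp add: shape_LB_tree)
  have a: "arches (lower_tree (beta_tree G)) = arches (mirror (LB_tree (shape G)))"
    unfolding beta_tree_def by (simp add: arches_lower_tree_LB_tree[OF compl_tree(1)[OF g]] low)
  have "mset (inorder (beta_tree G)) = mset (degrees (mirror (LB_tree (shape G))))"
    unfolding beta_tree_def mset_inorder_LB_tree
    by (simp add: inorder_eq_degrees_lower_tree[OF compl_tree(1)[OF g]] low)
  with a runs_eq_degrees_LB_tree[of "shape G"]
  show "hd (runs (dyck_word (shape G))) = arches (lower_tree (beta_tree G))"
    "mset (runs (dyck_word (shape G))) =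
      add_mset (arches (lower_tree (beta_tree G))) (mset (inorder (beta_tree G)))"
    by simp_all
qed

section \<open>Trees of paths whose rises are multiples of \<open>m\<close>\<close>

text \<open>\<open>k\<close> counts the up-steps which precede the word. A word satisfies this predicate for \<open>k = 0\<close> iff
  it is obtained from a word of ballot steps by \<^const>\<open>DD\<close>.\<close>
fun divisible_word :: "nat \<Rightarrow> nat \<Rightarrow> dyck_step list \<Rightarrow> bool" where
  "divisible_word m k [] \<longleftrightarrow> m dvd k"
| "divisible_word m k (Up # w) \<longleftrightarrow> divisible_word m (Suc k) w"
| "divisible_word m k (Down # w) \<longleftrightarrow> m dvd k \<and> divisible_word m k w"

text \<open>The sum in the last conjunct is the number of up-steps before the down-step that closes
  the node.\<close>

fun divisible_tree :: "nat \<Rightarrow> nat \<Rightarrow> 'a tree \<Rightarrow> bool" where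
  "divisible_tree m k Leaf \<longleftrightarrow> True"
| "divisible_tree m k (Node l x r) \<longleftrightarrow>
     divisible_tree m k l \<and> divisible_tree m (k + size l + 1) r \<and> m dvd k + size l + 1 + size r"

lemma divisible_word_iff_runs:
  "divisible_word m k w \<longleftrightarrow> m dvd k + hd (runs w) \<and> (\<forall>x \<in> set (tl (runs w)). m dvd x)"
proof (induction m k w rule: divisible_word.induct)
  case (3 m k w)
  have "set (runs w) = insert (hd (runs w)) (set (tl (runs w)))"
    by (metis list.exhaust_sel list.simps(15) runs_not_Nil)
  with 3 show ?case by (auto simp: dvd_add_right_iff)
qed simp_all

lemma divisible_word_0_iff_runs: "divisible_word m 0 w \<longleftrightarrow> (\<forall>x \<in> set (runs w). m dvd x)"
proof -
  have "set (runs w) = insert (hd (runs w)) (set (tl (runs w)))"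
    by (metis list.exhaust_sel list.simps(15) runs_not_Nil)
  then show ?thesis by (simp add: divisible_word_iff_runs)
qed

lemma divisible_word_dyck_word:
  "divisible_word m k (dyck_word T @ w) \<longleftrightarrow> divisible_tree m k T \<and> divisible_word m (k + size T) w"
  by (induction T arbitrary: k w) (auto simp: add_ac)

lemma divisible_tree_size: "divisible_tree m k T \<Longrightarrow> T \<noteq> Leaf \<Longrightarrow> m dvd k + size T"
  by (cases T) (auto simp: add_ac)

lemma divisible_tree_shape [simp]: "divisible_tree m k (shape T) \<longleftrightarrow> divisible_tree m k T"
  by (induction T arbitrary: k) auto

text \<open>After a rotation at the root the down-step of \<open>x\<close> is preceded by as many
  up-steps as that of \<open>y\<close>, so no new number has to be divisible. This is why the images
  of ballot paths form an upper ideal.\<close>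

lemma divisible_tree_rotation:
  "right_rotation S T \<Longrightarrow> divisible_tree m k S \<Longrightarrow> divisible_tree m k T"
  by (induction arbitrary: k rule: right_rotation.induct)
    (auto simp: right_rotation_size add_ac dest: right_rotation_size)

text \<open>A positive label at \<open>v_i\<close> says that \<open>v_(i+1)\<close> lies in the
  right subtree of \<open>v_i\<close> in the lower tree. Demanding this for all \<open>i\<close> not
  divisible by \<open>m\<close> is the chain condition of m-interval-posets.\<close>

fun positive_off_multiples :: "nat \<Rightarrow> nat \<Rightarrow> nat list \<Rightarrow> bool" where
  "positive_off_multiples m k [] \<longleftrightarrow> True"
| "positive_off_multiples m k (x # xs) \<longleftrightarrow>
     (m dvd Suc k \<or> 0 < x) \<and> positive_off_multiples m (Suc k) xs"

lemma positive_off_multiples_append [simp]: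
  "positive_off_multiples m k (xs @ ys) \<longleftrightarrow>
     positive_off_multiples m k xs \<and> positive_off_multiples m (k + length xs) ys"
  by (induction xs arbitrary: k) auto

text \<open>The last node has no right subtree.\<close>
lemma positive_off_multiples_degrees_size:
  "positive_off_multiples m k (degrees T) \<Longrightarrow> T \<noteq> Leaf \<Longrightarrow> m dvd k + size T"
proof (induction T arbitrary: k)
  case (Node l x r)
  show ?case
  proof (cases "r = Leaf")
    case True
    then show ?thesis using Node.prems by simp
  next
    case False
    then show ?thesis using Node.prems Node.IH(2)[of "k + size l + 1"] by (simp add: add_ac)
  qed
qed simp

text \<open>A run of up-steps ends at a node with empty right subtree. For other nodes the
  divisibility at the closing down-step is inherited from the last node of the right
  subtree.\<close>

lemma divisible_tree_iff_degrees:
  "divisible_tree m k T \<longleftrightarrow> positive_off_multiples m k (degrees T)"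
proof (induction T arbitrary: k)
  case (Node l x r)
  let ?c = "k + size l + 1"
  have "(m dvd ?c + size r \<and> positive_off_multiples m ?c (degrees r)) \<longleftrightarrow>
     ((m dvd ?c \<or> 0 < arches r) \<and> positive_off_multiples m ?c (degrees r))"
    using positive_off_multiples_degrees_size[of m ?c r] by (cases "r = Leaf") auto
  then show ?case using Node by (auto simp: add_ac)
qed simp

section \<open>Expansion and contraction\<close>

abbreviation expand_at :: "nat \<Rightarrow> nat \<Rightarrow> nat tree \<Rightarrow> nat tree" where
  "expand_at m k T \<equiv>
     map_tree (\<lambda>(i, l). if m dvd i then m * l else m * (l - 1)) (number k T)"

abbreviation contract_at :: "nat \<Rightarrow> nat \<Rightarrow> nat tree \<Rightarrow> nat tree" where
  "contract_at m k T \<equiv>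
     map_tree (\<lambda>(i, l). if m dvd i then exact_quotient l m else exact_quotient l m + 1)
       (number k T)"

lemma shape_number [simp]: "shape (map_tree f (number k T)) = shape T"
  by (induction T arbitrary: k) auto

lemma size_number [simp]: "size (number k T) = size T"
  by (induction T arbitrary: k) auto

lemma Suc_mod_cases:
  assumes "m \<ge> 1"
  shows "m dvd Suc k \<Longrightarrow> k mod m = m - 1"
    and "\<not> m dvd Suc k \<Longrightarrow> Suc k mod m = Suc (k mod m) \<and> Suc (k mod m) < m"
proof -
  have "k mod m < m" using assms by simp
  then show "m dvd Suc k \<Longrightarrow> k mod m = m - 1"
    "\<not> m dvd Suc k \<Longrightarrow> Suc k mod m = Suc (k mod m) \<and> Suc (k mod m) < m"
    by (auto simp: mod_Suc dvd_eq_mod_eq_0 split: if_splits)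
qed

text \<open>The correction \<open>k mod m\<close> comes from counting: arches are size minus labels,
  and if \<open>m\<close> divides \<open>k + size G\<close>, then the numbers from
  \<open>k + 1\<close> to \<open>k + size G\<close> contain \<open>(size G + k mod m) / m\<close>
  multiples of \<open>m\<close>.\<close>

lemma expand_at:
  assumes "m \<ge> 1" "grafting_tree G" "divisible_tree m k G" "positive_off_multiples m k (inorder G)"
  shows "grafting_tree (expand_at m k G) \<and>
    (m dvd k + size G \<longrightarrow>
       arches (lower_tree (expand_at m k G)) + k mod m = m * arches (lower_tree G)) \<and>
    slack (expand_at m k G) = m * slack G + (\<Sum>j = k..<k + size G. m - 1 - j mod m)"
  using assms(2-4)
proof (induction G arbitrary: k)
  case Leaf
  then show ?case by (simp add: dvd_eq_mod_eq_0)
next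
  case (Node l x r)
  define c where "c = k + size l + 1"
  define l' where "l' = expand_at m k l"
  define r' where "r' = expand_at m c r"
  define x' where "x' = (if m dvd c then m * x else m * (x - 1))"
  define a where "a = arches (lower_tree r)"
  define a' where "a' = arches (lower_tree r')"
  have E: "expand_at m k (Node l x r) = Node l' x' r'"
    by (simp add: l'_def r'_def x'_def c_def)
  have g: "grafting_tree l" "grafting_tree r" "x \<le> a"
    using Node.prems(1) unfolding grafting_tree_Node_iff a_def by blast+
  have d: "divisible_tree m k l" "divisible_tree m c r" "m dvd c + size r"
    using Node.prems(2) by (simp_all add: c_def)
  have p: "positive_off_multiples m k (inorder l)" "positive_off_multiples m c (inorder r)"
    "m dvd c \<or> 0 < x"
    using Node.prems(3) by (simp_all add: c_def)
  note L = Node.IH(1)[OF g(1) d(1) p(1), folded l'_def]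
  note R = Node.IH(2)[OF g(2) d(2) p(2), folded r'_def]
  let ?q = "(k + size l) mod m"
  have a': "a' + c mod m = m * a" using R d(3) by (simp add: a_def a'_def)
  \<comment> \<open>For \<open>m\<close> not dividing \<open>c\<close>, the bound drops by
    \<open>c mod m\<close> and the label by \<open>m\<close> relative to multiplication by
    \<open>m\<close>, leaving \<open>m - c mod m = m - 1 - ?q\<close>; for \<open>m\<close> dividing
    \<open>c\<close> this last term is 0.\<close>
  have node: "x' \<le> a' \<and> a' - x' = m * (a - x) + (m - 1 - ?q)"
  proof (cases "m dvd c")
    case True
    with Suc_mod_cases(1)[OF assms(1), of "k + size l"] have "?q = m - 1" by (simp add: c_def)
    moreover have "a' = m * a" using a' True by simp
    ultimately show ?thesis using g(3) True by (simp add: x'_def diff_mult_distrib2)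
  next
    case False
    with Suc_mod_cases(2)[OF assms(1), of "k + size l"]
    have q: "c mod m = Suc ?q" "Suc ?q < m" by (simp_all add: c_def)
    obtain y where y: "x = Suc y" using p(3) False by (cases x) auto
    obtain e where e: "a = x + e" using g(3) le_Suc_ex by blast
    have "a' + Suc ?q = m * y + m * e + m" using a' q y e by (simp add: algebra_simps)
    moreover have "x' = m * y" using False y by (simp add: x'_def)
    moreover have "m * (a - x) = m * e" using e by simp
    ultimately show ?thesis using q(2) by linarith
  qed
  have arches: "arches (lower_tree (Node l' x' r')) + k mod m =
      m * arches (lower_tree (Node l x r))" if "m dvd k + size (Node l x r)"
  proof -
    have eq: "arches (lower_tree (Node l' x' r')) =
        Suc (arches (lower_tree l') + (m * (a - x) + (m - 1 - ?q)))"
      "arches (lower_tree (Node l x r)) = Suc (arches (lower_tree l) + (a - x))"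
      using node g(3) by (simp_all add: a_def a'_def)
    have "?q < m" using assms(1) by simp
    show ?thesis
    \<comment> \<open>If \<open>l\<close> is empty, then \<open>?q = k mod m\<close>; otherwise
      \<open>l\<close> ends at a multiple of \<open>m\<close> and \<open>?q = 0\<close>.\<close>
    proof (cases "l = Leaf")
      case True
      then have "l' = Leaf" by (simp add: l'_def)
      with eq True \<open>?q < m\<close> show ?thesis by (simp add: algebra_simps)
    next
      case False
      with divisible_tree_size d(1) have dv: "m dvd k + size l" by blast
      with L have "arches (lower_tree l') + k mod m = m * arches (lower_tree l)" by blast
      moreover have "?q = 0" using dv by simp
      ultimately show ?thesis using eq assms(1) by (simp add: algebra_simps)
    qed
  qed
  have "{k..<k + size (Node l x r)} = {k..<k + size l} \<union> {k + size l} \<union> {c..<c + size r}"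
    by (auto simp: c_def)
  then have "(\<Sum>j = k..<k + size (Node l x r). m - 1 - j mod m) =
     (\<Sum>j = k..<k + size l. m - 1 - j mod m) + (m - 1 - ?q) +
     (\<Sum>j = c..<c + size r. m - 1 - j mod m)"
    by (simp add: c_def sum.union_disjoint)
  moreover have "slack (Node l' x' r') = slack l' + slack r' + (m * (a - x) + (m - 1 - ?q))"
    using node by (simp add: a'_def)
  ultimately have "slack (Node l' x' r') = m * slack (Node l x r) +
      (\<Sum>j = k..<k + size (Node l x r). m - 1 - j mod m)"
    using L R by (simp add: a_def algebra_simps)
  moreover have "grafting_tree (Node l' x' r')"
    unfolding grafting_tree_Node_iff using L R node by (simp add: a'_def)
  ultimately show ?case unfolding E using arches by blast
qed

lemma dvd_inorder_expand_at: "x \<in> set (inorder (expand_at m k G)) \<Longrightarrow> m dvd x"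
  by (induction G arbitrary: k) (auto split: if_splits)

lemma contract_at_expand_at:
  assumes "m \<ge> 1"
  shows "positive_off_multiples m k (inorder G) \<Longrightarrow> contract_at m k (expand_at m k G) = G"
  using assms by (induction G arbitrary: k) (auto simp: exact_quotient_def)

lemma expand_at_contract_at:
  assumes "m \<ge> 1"
  shows "\<forall>x \<in> set (inorder F). m dvd x \<Longrightarrow> expand_at m k (contract_at m k F) = F"
  using assms by (induction F arbitrary: k) (auto simp: exact_quotient_def)

lemma positive_inorder_contract_at: "positive_off_multiples m k (inorder (contract_at m k F))"
  by (induction F arbitrary: k) auto

lemma divisible_tree_contract_at:
  "divisible_tree m j (contract_at m k F) \<longleftrightarrow> divisible_tree m j F"
  using divisible_tree_shape[of m j "contract_at m k F"] divisible_tree_shape[of m j F]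
  by (simp only: shape_number)

text \<open>The bound for a contracted label is obtained by expanding the contracted right subtree
  again and applying \<open>expand_at\<close> to it.\<close>

lemma grafting_tree_contract_at:
  assumes "m \<ge> 1" "grafting_tree F" "divisible_tree m k F" "\<forall>x \<in> set (inorder F). m dvd x"
  shows "grafting_tree (contract_at m k F)"
  using assms(2-4)
proof (induction F arbitrary: k)
  case (Node l x r)
  define c where "c = k + size l + 1"
  define r' where "r' = contract_at m c r"
  define y where "y = x div m"
  have xy: "x = m * y" "exact_quotient x m = y"
    using Node.prems(3) by (simp_all add: y_def exact_quotient_def)
  have g: "grafting_tree l" "grafting_tree r" "x \<le> arches (lower_tree r)"
    using Node.prems(1) unfolding grafting_tree_Node_iff by blast+
  have d: "divisible_tree m k l" "divisible_tree m c r" "m dvd c + size r"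
    using Node.prems(2) by (simp_all add: c_def)
  have gl: "grafting_tree (contract_at m k l)" and gr: "grafting_tree r'"
    unfolding r'_def using Node.IH g d Node.prems(3) by simp_all
  have "expand_at m c r' = r" unfolding r'_def
    using Node.prems(3) by (intro expand_at_contract_at[OF assms(1)]) simp
  with expand_at[OF assms(1) gr, of c] d
  have eq: "arches (lower_tree r) + c mod m = m * arches (lower_tree r')"
    by (simp add: r'_def divisible_tree_contract_at positive_inorder_contract_at)
  have "(if m dvd c then y else y + 1) \<le> arches (lower_tree r')"
  proof (cases "m dvd c")
    case True
    then have "m * y \<le> m * arches (lower_tree r')" using eq g(3) xy by simp
    then show ?thesis using True assms(1) by simp
  next
    \<comment> \<open>The nonzero remainder makes the inequality strict, which leaves room for the
      added 1.\<close>
    case False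
    then have "0 < c mod m" by (simp add: dvd_eq_mod_eq_0)
    then have "m * y < m * arches (lower_tree r')" using eq g(3) xy by linarith
    then show ?thesis using False by simp
  qed
  moreover have "contract_at m k (Node l x r) =
      Node (contract_at m k l) (if m dvd c then y else y + 1) r'"
    by (simp add: c_def r'_def xy(2))
  ultimately show ?case
    using gl gr by (simp only: grafting_tree_Node_iff simp_thms)
qed simp

section \<open>Grafting trees of m-Tamari intervals\<close>

definition mgrafting_tree :: "nat \<Rightarrow> nat \<Rightarrow> nat tree \<Rightarrow> bool" where
  "mgrafting_tree m n G \<longleftrightarrow>
     grafting_tree G \<and> size G = n * m \<and> divisible_tree m 0 (lower_tree G)"

definition mbeta_tree :: "nat \<Rightarrow> nat tree \<Rightarrow> nat tree" where
  "mbeta_tree m G = contract_tree m (beta_tree (expand_tree m G))"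

lemma divisible_tree_rotations:
  "(right_rotation ^^ j) S T \<Longrightarrow> divisible_tree m k S \<Longrightarrow> divisible_tree m k T"
  by (induction j arbitrary: T) (auto dest: divisible_tree_rotation)

text \<open>The upper tree inherits divisibility from the lower one, as it is reached by right
  rotations.\<close>

lemma mgrafting_tree_divisible_shape:
  "mgrafting_tree m n G \<Longrightarrow> divisible_tree m 0 (shape G)"
  using divisible_tree_rotations[OF rotations_lower_to_shape]
  unfolding mgrafting_tree_def by blast

lemma mgrafting_tree_positive:
  "mgrafting_tree m n G \<Longrightarrow> positive_off_multiples m 0 (inorder G)"
  by (simp add: mgrafting_tree_def inorder_eq_degrees_lower_tree divisible_tree_iff_degrees)

lemma divisible_tree_0_iff_runs:
  assumes "m dvd size T"
  shows "divisible_tree m 0 T \<longleftrightarrow> (\<forall>x \<in> set (runs (dyck_word T)). m dvd x)"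
  using divisible_word_dyck_word[of m 0 T "[]"] assms by (simp add: divisible_word_0_iff_runs)

lemma mgrafting_tree_expand:
  assumes "m \<ge> 1" "mgrafting_tree m n G"
  shows "grafting_tree (expand_tree m G)"
    and "arches (lower_tree (expand_tree m G)) = m * arches (lower_tree G)"
    and "slack (expand_tree m G) = m * slack G + (\<Sum>j < n * m. m - 1 - j mod m)"
    and "contract_tree m (expand_tree m G) = G"
  using expand_at[OF assms(1), of G 0] contract_at_expand_at[OF assms(1), of 0 G]
    mgrafting_tree_divisible_shape[OF assms(2)] mgrafting_tree_positive[OF assms(2)] assms(2)
  by (simp_all add: expand_tree_def contract_tree_def mgrafting_tree_def atLeast0LessThan)

lemma mbeta_tree:
  assumes m: "m \<ge> 1" and G: "mgrafting_tree m n G"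
  shows "mgrafting_tree m n (mbeta_tree m G)"
    and "expand_tree m (mbeta_tree m G) = beta_tree (expand_tree m G)"
    and "mbeta_tree m (mbeta_tree m G) = G"
    and "slack (mbeta_tree m G) = slack G"
proof -
  define E where "E = expand_tree m G"
  define F where "F = beta_tree E"
  define H where "H = contract_tree m F"
  have H: "mbeta_tree m G = H" by (simp add: mbeta_tree_def E_def F_def H_def)
  have gE: "grafting_tree E" and aE: "arches (lower_tree E) = m * arches (lower_tree G)"
    and cE: "contract_tree m E = G"
    using mgrafting_tree_expand[OF m G] by (simp_all add: E_def)
  have sE: "size E = n * m" using G by (simp add: E_def expand_tree_def mgrafting_tree_def)
  have gF: "grafting_tree F" and FE: "beta_tree F = E" and sF: "size F = n * m"
    using gE sE by (simp_all add: F_def grafting_tree_beta_tree beta_tree_involution size_beta_tree)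
  have "divisible_tree m 0 (shape E)"
    using mgrafting_tree_divisible_shape[OF G] by (simp add: E_def expand_tree_def)
  then have "\<forall>x \<in># mset (runs (dyck_word (shape E))). m dvd x"
    using divisible_tree_0_iff_runs[of m "shape E"] sE by simp
  then have dF: "\<forall>x \<in> set (inorder F). m dvd x"
    unfolding runs_eq_labels_beta_tree(2)[OF gE] F_def by simp
  \<comment> \<open>Since \<open>beta_tree F = E\<close>, the runs of \<open>F\<close> are the
    labels of \<open>E\<close> and its number of arches, the latter being a multiple of
    \<open>m\<close> by \<open>aE\<close>.\<close>
  have "\<forall>x \<in># mset (runs (dyck_word (shape F))). m dvd x"
    unfolding runs_eq_labels_beta_tree(2)[OF gF] FE
    using aE dvd_inorder_expand_at[of _ m 0 G] by (auto simp: E_def expand_tree_def)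
  then have "divisible_tree m 0 (shape F)"
    using divisible_tree_0_iff_runs[of m "shape F"] sF by simp
  then have "divisible_tree m 0 F" by simp
  then have gH: "grafting_tree H"
    unfolding H_def contract_tree_def by (intro grafting_tree_contract_at m gF dF)
  \<comment> \<open>Contraction makes labels off the multiples of \<open>m\<close> positive, which
    is divisibility of the lower tree.\<close>
  have pH: "positive_off_multiples m 0 (inorder H)"
    by (simp add: H_def contract_tree_def positive_inorder_contract_at)
  have mH: "mgrafting_tree m n H"
    unfolding mgrafting_tree_def divisible_tree_iff_degrees
      inorder_eq_degrees_lower_tree[OF gH, symmetric]
    using gH pH sF by (simp add: H_def contract_tree_def)
  have eH: "expand_tree m H = F"
    using expand_at_contract_at[OF m dF, of 0] by (simp add: H_def contract_tree_def expand_tree_def)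
  have "m * slack H = m * slack G"
    using mgrafting_tree_expand(3)[OF m mH] mgrafting_tree_expand(3)[OF m G] slack_beta_tree[OF gE]
    by (simp add: eH E_def F_def)
  then show "slack (mbeta_tree m G) = slack G" using m H by simp
  show "mgrafting_tree m n (mbeta_tree m G)" using mH H by simp
  show "expand_tree m (mbeta_tree m G) = beta_tree (expand_tree m G)"
    using eH H by (simp add: F_def E_def)
  show "mbeta_tree m (mbeta_tree m G) = G"
    using eH FE cE unfolding H by (simp add: mbeta_tree_def)
qed

lemma contract_beta_expand_Graft_inv:
  assumes "m \<ge> 1" "mgrafting_tree m n G"
  shows "(contract m \<circ> beta \<circ> expand m) (Graft_inv G) = Graft_inv (mbeta_tree m G)"
proof -
  have "grafting_tree G" using assms(2) by (simp add: mgrafting_tree_def)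
  with mgrafting_tree_expand(1)[OF assms] show ?thesis
    by (simp add: contract_def expand_def beta_Graft_inv Graft_Graft_inv grafting_tree_beta_tree
        mbeta_tree_def)
qed

section \<open>Ballot paths and their trees\<close>

lemma DD_simps [simp]:
  "DD m [] = []"
  "DD m (Vert # B) = replicate m Up @ DD m B"
  "DD m (Horiz # B) = Down # DD m B"
  by (simp_all add: DD_def)

lemma inj_DD: "m \<ge> 1 \<Longrightarrow> DD m B = DD m B' \<Longrightarrow> B = B'"
proof (induction B arbitrary: B')
  case Nil
  then show ?case by (cases B' rule: list.exhaust[case_names Nil Cons])
    (auto split: ballot_step.splits simp: DD_def)
next
  case (Cons s B)
  then obtain p where p: "m = Suc p" by (cases m) auto
  obtain s' B'' where B': "B' = s' # B''"
    using Cons.prems p by (cases B') (cases s; auto)+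
  from Cons.prems p have "s = s' \<and> DD m B = DD m B''"
    unfolding B' by (cases s; cases s') auto
  with Cons B' show ?case by simp
qed

text \<open>A stack machine: each entry collects the arches read so far on one nesting level. On
  underflow it returns the empty stack. It recovers a tree from its word and so proves injectivity,
  on which the \<open>inv\<close> in \<open>dyck_tree\<close> relies.\<close>

fun parse :: "unit tree list \<Rightarrow> dyck_step list \<Rightarrow> unit tree list" where
  "parse ts [] = ts"
| "parse ts (Up # w) = parse (Leaf # ts) w"
| "parse (r # l # ts) (Down # w) = parse (Node l () r # ts) w"
| "parse ts (Down # w) = []"

lemma parse_dyck_word: "parse (t # ts) (dyck_word T @ w) = parse (attach_leftmost T t # ts) w"
  by (induction T arbitrary: t ts w) auto

lemma inj_dyck_word: "dyck_word S = dyck_word T \<Longrightarrow> S = T"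
  using parse_dyck_word[of Leaf "[]" S "[]"] parse_dyck_word[of Leaf "[]" T "[]"] by simp

lemma dyck_tree_dyck_word [simp]: "dyck_tree (dyck_word T) = T"
  unfolding dyck_tree_def by (rule inv_f_f) (auto intro: injI inj_dyck_word)

fun dyck_from :: "nat \<Rightarrow> dyck_step list \<Rightarrow> bool" where
  "dyck_from h [] \<longleftrightarrow> h = 0"
| "dyck_from h (Up # w) \<longleftrightarrow> dyck_from (Suc h) w"
| "dyck_from h (Down # w) \<longleftrightarrow> 0 < h \<and> dyck_from (h - 1) w"

lemma dyck_from_dyck_word: "dyck_from h (dyck_word T @ w) \<longleftrightarrow> dyck_from h w"
  by (induction T arbitrary: h w) auto

text \<open>The word is cut at its first passages to the heights \<open>h - 1\<close>, ...,
  0.\<close>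

lemma dyck_from_decompose:
  "dyck_from h w \<Longrightarrow>
   \<exists>T Ts. length Ts = h \<and> w = dyck_word T @ concat (map (\<lambda>T. Down # dyck_word T) Ts)"
proof (induction h w rule: dyck_from.induct)
  case (1 h)
  then show ?case by (intro exI[of _ Leaf] exI[of _ "[]"]) simp
next
  case (2 h w)
  then obtain T Ts where T: "length Ts = Suc h"
    "w = dyck_word T @ concat (map (\<lambda>T. Down # dyck_word T) Ts)" by auto
  then obtain T' Ts' where Ts: "Ts = T' # Ts'" by (cases Ts) auto
  have "Up # w = dyck_word (attach_leftmost T' (Node Leaf () T)) @
      concat (map (\<lambda>T. Down # dyck_word T) Ts')"
    using T Ts by simp
  with T Ts show ?case by (metis length_Cons nat.inject)
next
  case (3 h w)
  then obtain T Ts where "length Ts = h - 1"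
    "w = dyck_word T @ concat (map (\<lambda>T. Down # dyck_word T) Ts)" by auto
  with 3(2) show ?case by (intro exI[of _ Leaf] exI[of _ "T # Ts"]) simp
qed

lemma dyck_from_0_imp_dyck_word: "dyck_from 0 w \<Longrightarrow> \<exists>T. w = dyck_word T"
  using dyck_from_decompose[of 0 w] by auto

lemma xpos_simps [simp]:
  "xpos B 0 = 0" "xpos [] k = 0"
  "xpos (Vert # B) (Suc k) = xpos B k" "xpos (Horiz # B) (Suc k) = Suc (xpos B k)"
  by (simp_all add: xpos_def)

lemma ypos_simps [simp]:
  "ypos B 0 = 0" "ypos [] k = 0"
  "ypos (Vert # B) (Suc k) = Suc (ypos B k)" "ypos (Horiz # B) (Suc k) = ypos B k"
  by (simp_all add: ypos_def)

lemma all_le_Suc_conv: "(\<forall>k \<le> Suc n. P k) \<longleftrightarrow> P 0 \<and> (\<forall>k \<le> n. P (Suc k))"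
  by (metis Suc_le_mono le0 not0_implies_Suc)

lemma dyck_from_replicate: "dyck_from h (replicate j Up @ w) \<longleftrightarrow> dyck_from (h + j) w"
  by (induction j arbitrary: h) auto

lemma dyck_from_DD_iff:
  "dyck_from h (DD m B) \<longleftrightarrow>
     count_list B Horiz = h + m * count_list B Vert \<and>
     (\<forall>k \<le> length B. xpos B k \<le> h + m * ypos B k)"
proof (induction B arbitrary: h)
  case (Cons s B)
  show ?case
  proof (cases s)
    case Vert
    then show ?thesis
      using Cons[of "h + m"] by (simp add: dyck_from_replicate all_le_Suc_conv add_ac)
  next
    case Horiz
    then show ?thesis
    proof (cases h)
      case 0
      have "\<not> (\<forall>k \<le> length (s # B). xpos (s # B) k \<le> m * ypos (s # B) k)"
        using Horiz by (auto simp: all_le_Suc_conv intro!: exI[of _ 0])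
      then show ?thesis using 0 Horiz by simp
    next
      case (Suc h')
      then show ?thesis using Horiz Cons[of h'] by (simp add: all_le_Suc_conv)
    qed
  qed
qed auto

lemma ballot_path_iff: "ballot_path m n B \<longleftrightarrow> count_list B Vert = n \<and> dyck_from 0 (DD m B)"
  by (auto simp: ballot_path_def dyck_from_DD_iff mult.commute)

lemma count_list_dyck_word: "count_list (dyck_word T) Up = size T"
  by (induction T) auto

lemma count_list_DD: "count_list (DD m B) Up = m * count_list B Vert"
proof (induction B)
  case (Cons s B)
  have "count_list (replicate m Up) Up = m" by (induction m) auto
  with Cons show ?case by (cases s) auto
qed simp

lemma divisible_word_replicate:
  "divisible_word m k (replicate j Up @ w) \<longleftrightarrow> divisible_word m (k + j) w"
  by (induction j arbitrary: k) auto

lemma divisible_word_DD: "m dvd k \<Longrightarrow> divisible_word m k (DD m B)"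
proof (induction B arbitrary: k)
  case (Cons s B)
  then show ?case by (cases s) (auto simp: divisible_word_replicate)
qed simp

text \<open>The \<open>k mod m\<close> restored up-steps belong to a vertical step that is not yet
  complete.\<close>

lemma divisible_word_imp_DD:
  assumes "m \<ge> 1"
  shows "divisible_word m k w \<Longrightarrow> \<exists>B. DD m B = replicate (k mod m) Up @ w"
proof (induction m k w rule: divisible_word.induct)
  case (1 m k)
  then show ?case by (intro exI[of _ "[]"]) simp
next
  case (2 m k w)
  then obtain B where B: "DD m B = replicate (Suc k mod m) Up @ w" by auto
  show ?case
  \<comment> \<open>The induction also varies \<open>m\<close>, so \<open>m = 0\<close> occurs;
    there \<open>k mod m = k\<close>, and the pending up-steps just accumulate.\<close>
  proof (cases "m = 0 \<or> \<not> m dvd Suc k")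
    case True
    then have "Suc k mod m = Suc (k mod m)" using Suc_mod_cases(2)[of m k] by (cases "m = 0") auto
    with B show ?thesis by (auto simp: replicate_app_Cons_same)
  next
    case False
    then have "k mod m = m - 1" using Suc_mod_cases(1)[of m k] by simp
    moreover have "replicate (m - 1) Up @ Up # w = replicate m Up @ w"
      using False by (cases m) (auto simp: replicate_app_Cons_same)
    moreover have "DD m B = w" using B False by simp
    ultimately show ?thesis by (intro exI[of _ "Vert # B"]) simp
  qed
next
  case (3 m k w)
  then obtain B where "DD m B = replicate (k mod m) Up @ w" by auto
  with 3 show ?case by (intro exI[of _ "Horiz # B"]) simp
qed

lemma ballot_path_tree:
  assumes "ballot_path m n B"
  obtains T where "DD m B = dyck_word T" "size T = n * m" "divisible_tree m 0 T"
proof -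
  from assms obtain T where T: "DD m B = dyck_word T"
    using dyck_from_0_imp_dyck_word ballot_path_iff by blast
  moreover have "size T = n * m"
    using T count_list_dyck_word[of T] count_list_DD[of m B] assms
    by (simp add: ballot_path_def mult.commute)
  moreover have "divisible_tree m 0 T"
    using divisible_word_DD[of m 0 B] T divisible_word_dyck_word[of m 0 T "[]"] by simp
  ultimately show thesis by (rule that)
qed

lemma tree_ballot_path:
  assumes "m \<ge> 1" "size T = n * m" "divisible_tree m 0 T"
  obtains B where "ballot_path m n B" "DD m B = dyck_word T"
proof -
  have "divisible_word m 0 (dyck_word T)"
    using divisible_word_dyck_word[of m 0 T "[]"] assms by simp
  from divisible_word_imp_DD[OF assms(1) this] obtain B where B: "DD m B = dyck_word T" by auto
  have "m * count_list B Vert = m * n"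
    using count_list_dyck_word[of T] count_list_DD[of m B] assms B by simp
  then have "ballot_path m n B"
    using assms(1) B dyck_from_dyck_word[of 0 T "[]"] by (simp add: ballot_path_iff)
  with B show thesis using that by blast
qed

section \<open>Intervals and distance in the m-Tamari order\<close>

definition encodes :: "nat \<Rightarrow> nat \<Rightarrow> nat tree \<Rightarrow> interval \<Rightarrow> bool" where
  "encodes m n G I \<longleftrightarrow> mgrafting_tree m n G \<and> I \<in> mtam_intervals m n \<and>
     DD m (fst I) = dyck_word (lower_tree G) \<and> DD m (snd I) = dyck_word (shape G)"

lemma mtam_interval_encoded:
  assumes "I \<in> mtam_intervals m n"
  shows "\<exists>G. encodes m n G I"
proof -
  obtain B1 B2 where I: "I = (B1, B2)" by (cases I)
  have b: "ballot_path m n B1" "ballot_path m n B2" "tamari_le (DD m B1) (DD m B2)"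
    using assms by (auto simp: I mtam_intervals_def mtam_le_def)
  obtain S where S: "DD m B1 = dyck_word S" "size S = n * m" "divisible_tree m 0 S"
    using ballot_path_tree[OF b(1)] .
  obtain T where T: "DD m B2 = dyck_word T" using ballot_path_tree[OF b(2)] .
  have "right_rotation\<^sup>*\<^sup>* S T" using b(3) S T by (simp add: tamari_le_def)
  then obtain k where "(right_rotation ^^ k) S T" by (auto simp: rtranclp_power)
  from grafting_tree_of_rotations[OF this] obtain G where
    "grafting_tree G" "lower_tree G = S" "shape G = T" by blast
  with S T assms I show ?thesis
    by (intro exI[of _ G]) (auto simp: encodes_def mgrafting_tree_def)
qed

lemma mgrafting_tree_encodes:
  assumes "m \<ge> 1" "mgrafting_tree m n G"
  shows "\<exists>I. encodes m n G I"
proof -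
  have G: "grafting_tree G" "size G = n * m" "divisible_tree m 0 (lower_tree G)"
    using assms(2) by (auto simp: mgrafting_tree_def)
  obtain B1 where B1: "ballot_path m n B1" "DD m B1 = dyck_word (lower_tree G)"
    using tree_ballot_path[of m "lower_tree G" n] assms G by auto
  obtain B2 where B2: "ballot_path m n B2" "DD m B2 = dyck_word (shape G)"
    using tree_ballot_path[of m "shape G" n] assms G mgrafting_tree_divisible_shape[OF assms(2)]
    by auto
  have "right_rotation\<^sup>*\<^sup>* (lower_tree G) (shape G)"
    using rotations_lower_to_shape[OF G(1)] by (auto simp: rtranclp_power)
  with B1 B2 have "(B1, B2) \<in> mtam_intervals m n"
    by (simp add: mtam_intervals_def mtam_le_def tamari_le_def)
  with B1 B2 assms(2) show ?thesis by (intro exI[of _ "(B1, B2)"]) (simp add: encodes_def)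
qed

lemma encodes_inject:
  assumes "m \<ge> 1" "encodes m n G I" "encodes m n G J"
  shows "I = J"
proof -
  have "DD m (fst I) = DD m (fst J)" "DD m (snd I) = DD m (snd J)"
    using assms by (simp_all add: encodes_def)
  with inj_DD[OF assms(1)] show ?thesis by (simp add: prod_eq_iff)
qed

lemma mtam_iposet_encoded:
  assumes "encodes m n G I"
  shows "mtam_iposet m n I = Graft_inv G"
  using assms
  by (simp add: encodes_def mtam_iposet_def tamari_iposet_eq mgrafting_tree_def
      Graft_inv_eq_graft_iposet graft_iposet_def)

lemma inj_on_mtam_iposet:
  assumes "m \<ge> 1"
  shows "inj_on (mtam_iposet m n) (mtam_intervals m n)"
proof (rule inj_onI)
  fix I J assume *: "I \<in> mtam_intervals m n" "J \<in> mtam_intervals m n"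
    "mtam_iposet m n I = mtam_iposet m n J"
  obtain G H where G: "encodes m n G I" and H: "encodes m n H J"
    using mtam_interval_encoded * by blast
  with *(3) have "Graft_inv G = Graft_inv H" by (simp add: mtam_iposet_encoded)
  moreover have "grafting_tree G" "grafting_tree H"
    using G H by (auto simp: encodes_def mgrafting_tree_def)
  ultimately have "G = H" using inj_on_Graft_inv by (auto dest: inj_onD)
  with G H encodes_inject[OF assms] show "I = J" by blast
qed

lemma encodes_beta_m:
  assumes "m \<ge> 1" "encodes m n G I"
  shows "encodes m n (mbeta_tree m G) (beta_m m n I)"
proof -
  have G: "mgrafting_tree m n G" using assms(2) by (simp add: encodes_def)
  obtain J where J: "encodes m n (mbeta_tree m G) J"
    using mgrafting_tree_encodes[OF assms(1) mbeta_tree(1)[OF assms(1) G]] by blast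
  have "beta_m m n I = inv_into (mtam_intervals m n) (mtam_iposet m n) (mtam_iposet m n J)"
    unfolding beta_m_def mtam_iposet_encoded[OF assms(2)] mtam_iposet_encoded[OF J]
      contract_beta_expand_Graft_inv[OF assms(1) G] ..
  also have "\<dots> = J"
    using J by (intro inv_into_f_f inj_on_mtam_iposet assms(1)) (simp add: encodes_def)
  finally show ?thesis using J by simp
qed

fun right_weight :: "'a tree \<Rightarrow> nat" where
  "right_weight Leaf = 0"
| "right_weight (Node l x r) = right_weight l + size r + right_weight r"

text \<open>A rotation enlarges one right subtree and keeps the sizes of the others. This rules out
  cycles of rotations.\<close>

lemma right_weight_rotation: "right_rotation S T \<Longrightarrow> right_weight S < right_weight T"
  by (induction rule: right_rotation.induct) (auto dest: right_rotation_size)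

lemma right_weight_rotations:
  "(right_rotation ^^ k) S T \<Longrightarrow> right_weight S + k \<le> right_weight T"
proof (induction k arbitrary: T)
  case (Suc k)
  then obtain U where "(right_rotation ^^ k) S U" "right_rotation U T" by auto
  with Suc.IH right_weight_rotation show ?case by fastforce
qed simp

lemma mtam_less_rotations:
  assumes "m \<ge> 1" "mtam_less m n B B'"
  obtains k where "k \<ge> 1" "(right_rotation ^^ k) (dyck_tree (DD m B)) (dyck_tree (DD m B'))"
proof -
  have b: "ballot_path m n B" "ballot_path m n B'" "tamari_le (DD m B) (DD m B')" "B \<noteq> B'"
    using assms(2) by (auto simp: mtam_less_def mtam_le_def)
  obtain S T where S: "DD m B = dyck_word S" and T: "DD m B' = dyck_word T"
    using ballot_path_tree b(1,2) by metis
  have "S \<noteq> T" using b(4) S T inj_DD[OF assms(1)] by metis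
  moreover obtain k where k: "(right_rotation ^^ k) S T"
    using b(3) S T by (auto simp: tamari_le_def rtranclp_power)
  ultimately have "k \<ge> 1" by (cases k) auto
  with k S T that show thesis by simp
qed

lemma mtam_less_if_rotations:
  assumes "k \<ge> 1" "ballot_path m n B" "ballot_path m n B'"
    and "(right_rotation ^^ k) (dyck_tree (DD m B)) (dyck_tree (DD m B'))"
  shows "mtam_less m n B B'"
proof -
  have "B \<noteq> B'" using right_weight_rotations[OF assms(4)] assms(1) by auto
  moreover have "tamari_le (DD m B) (DD m B')"
    using assms(4) by (auto simp: tamari_le_def rtranclp_power)
  ultimately show ?thesis using assms by (simp add: mtam_less_def mtam_le_def)
qed

lemma transp_mtam_less:
  assumes "m \<ge> 1"
  shows "transp (mtam_less m n)"
proof (rule transpI)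
  fix B B' B'' assume *: "mtam_less m n B B'" "mtam_less m n B' B''"
  obtain j where j: "j \<ge> 1" "(right_rotation ^^ j) (dyck_tree (DD m B)) (dyck_tree (DD m B'))"
    using mtam_less_rotations[OF assms *(1)] .
  obtain k where k: "k \<ge> 1" "(right_rotation ^^ k) (dyck_tree (DD m B')) (dyck_tree (DD m B''))"
    using mtam_less_rotations[OF assms *(2)] .
  show "mtam_less m n B B''"
    using relpowp_trans[OF j(2) k(2)] j *
    by (intro mtam_less_if_rotations[of "j + k"]) (auto simp: mtam_less_def mtam_le_def)
qed

lemma chain_rotations:
  assumes "m \<ge> 1" "c \<noteq> []" "sorted_wrt (mtam_less m n) c"
  shows "\<exists>k \<ge> length c - 1.
    (right_rotation ^^ k) (dyck_tree (DD m (hd c))) (dyck_tree (DD m (last c)))"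
  using assms(2,3)
proof (induction c rule: list_nonempty_induct)
  case (single B)
  then show ?case by (intro exI[of _ 0]) simp
next
  case (cons B c)
  then obtain k where k: "k \<ge> length c - 1"
    "(right_rotation ^^ k) (dyck_tree (DD m (hd c))) (dyck_tree (DD m (last c)))" by auto
  have "mtam_less m n B (hd c)" using cons by simp
  then obtain j where j: "j \<ge> 1" "(right_rotation ^^ j) (dyck_tree (DD m B)) (dyck_tree (DD m (hd c)))"
    using mtam_less_rotations[OF assms(1)] by blast
  from relpowp_trans[OF j(2) k(2)] j(1) k(1) cons(1) show ?case
    by (intro exI[of _ "j + k"]) auto
qed

text \<open>All intermediate trees of a chain of rotations stay divisible, hence come from ballot
  paths: passing to the m-Tamari order shortens no chain.\<close>

lemma rotations_chain:
  assumes "m \<ge> 1" "ballot_path m n B" "ballot_path m n B'"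
    and "(right_rotation ^^ k) (dyck_tree (DD m B)) (dyck_tree (DD m B'))"
  shows "\<exists>c. c \<noteq> [] \<and> hd c = B \<and> last c = B' \<and> sorted_wrt (mtam_less m n) c \<and> length c = Suc k"
  using assms(2,4)
proof (induction k arbitrary: B)
  case 0
  obtain S T where "DD m B = dyck_word S" "DD m B' = dyck_word T"
    using ballot_path_tree 0(1) assms(3) by metis
  with 0 have "DD m B = DD m B'" by simp
  then have "B = B'" by (rule inj_DD[OF assms(1)])
  then show ?case by (intro exI[of _ "[B]"]) simp
next
  case (Suc k)
  obtain S where S: "DD m B = dyck_word S" "size S = n * m" "divisible_tree m 0 S"
    using ballot_path_tree[OF Suc.prems(1)] .
  from relpowp_Suc_D2[OF Suc.prems(2)] obtain U where
    U: "right_rotation S U" "(right_rotation ^^ k) U (dyck_tree (DD m B'))" using S by auto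
  obtain C where C: "ballot_path m n C" "DD m C = dyck_word U"
    using tree_ballot_path[OF assms(1), of U n] right_rotation_size[OF U(1)]
      divisible_tree_rotation[OF U(1)] S by metis
  with Suc.IH[of C] U obtain c where c: "c \<noteq> []" "hd c = C" "last c = B'"
    "sorted_wrt (mtam_less m n) c" "length c = Suc k" by auto
  have less: "mtam_less m n B C"
    using U(1) S C Suc.prems(1) by (intro mtam_less_if_rotations[of 1]) auto
  obtain c' where "c = C # c'" using c by (cases c) auto
  with c less transp_mtam_less[OF assms(1), of n] have "sorted_wrt (mtam_less m n) (B # c)"
    by (auto dest: transpD)
  with c show ?case by (intro exI[of _ "B # c"]) simp
qed

lemma mtam_dist_encoded:
  assumes "m \<ge> 1" "encodes m n G I"
  shows "mtam_dist m n I = slack G"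
proof -
  let ?D = "{length c - 1 | c. c \<noteq> [] \<and> hd c = fst I \<and> last c = snd I \<and>
                            sorted_wrt (mtam_less m n) c}"
  have G: "grafting_tree G" and t: "dyck_tree (DD m (fst I)) = lower_tree G"
    "dyck_tree (DD m (snd I)) = shape G"
    and b: "ballot_path m n (fst I)" "ballot_path m n (snd I)"
    using assms(2) by (auto simp: encodes_def mgrafting_tree_def mtam_intervals_def mtam_le_def)
  have le: "d \<le> slack G" if "d \<in> ?D" for d
  proof -
    from that obtain c where c: "d = length c - 1" "c \<noteq> []" "hd c = fst I" "last c = snd I"
      "sorted_wrt (mtam_less m n) c" by blast
    from chain_rotations[OF assms(1) c(2,5)] c t obtain k where
      "k \<ge> d" "(right_rotation ^^ k) (lower_tree G) (shape G)" by auto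
    with rotations_le_slack[OF G] show ?thesis by fastforce
  qed
  moreover have "slack G \<in> ?D"
  proof -
    have "(right_rotation ^^ slack G) (dyck_tree (DD m (fst I))) (dyck_tree (DD m (snd I)))"
      using rotations_lower_to_shape[OF G] t by simp
    from rotations_chain[OF assms(1) b this] show ?thesis by force
  qed
  moreover have "finite ?D" using le by (meson finite_nat_set_iff_bounded_le)
  ultimately show ?thesis unfolding mtam_dist_def by (intro Max_eqI) auto
qed

section \<open>Rise and contact vectors\<close>

text \<open>Replaces the indexing by the \<open>i\<close>-th step in the statistics with recursion
  along the path.\<close>

fun suffixes_after :: "'a \<Rightarrow> 'a list \<Rightarrow> 'a list list" where
  "suffixes_after s [] = []"
| "suffixes_after s (x # B) = (if x = s then [B] else []) @ suffixes_after s B"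

lemma length_suffixes_after: "length (suffixes_after s B) = count_list B s"
  by (induction B) auto

lemma suffixes_after_eq:
  "suffixes_after s B = map (\<lambda>k. drop (k + 1) B) (filter (\<lambda>k. B ! k = s) [0..<length B])"
proof (induction B)
  case (Cons x B)
  have "[0..<length (x # B)] = 0 # map Suc [0..<length B]"
    by (simp add: map_Suc_upt upt_conv_Cons del: upt_Suc)
  then show ?case using Cons by (simp add: filter_map comp_def del: upt_Suc)
qed simp

lemma map_drop_nth_step:
  "map (\<lambda>i. f (drop (nth_step s B i + 1) B)) [1..<count_list B s + 1] =
     map f (suffixes_after s B)"
proof (rule nth_equalityI)
  fix i assume i: "i < length (map (\<lambda>i. f (drop (nth_step s B i + 1) B)) [1..<count_list B s + 1])"
  have "length (filter (\<lambda>k. B ! k = s) [0..<length B]) = count_list B s"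
    using length_suffixes_after[of s B] by (simp add: suffixes_after_eq)
  with i show "map (\<lambda>i. f (drop (nth_step s B i + 1) B)) [1..<count_list B s + 1] ! i =
      map f (suffixes_after s B) ! i"
    by (simp add: suffixes_after_eq nth_step_def del: upt_Suc)
qed (simp add: length_suffixes_after)

definition ballot_runs :: "ballot_step list \<Rightarrow> nat list" where
  "ballot_runs B = initial_verts B # map initial_verts (suffixes_after Horiz B)"

lemma runs_replicate: "runs (replicate j Up @ w) = (j + hd (runs w)) # tl (runs w)"
  by (induction j) auto

lemma runs_DD: "runs (DD m B) = map ((*) m) (ballot_runs B)"
proof (induction B)
  case Nil
  show ?case by (simp add: ballot_runs_def initial_verts_def)
next
  case (Cons s B)
  then show ?case
    by (cases s) (auto simp: ballot_runs_def initial_verts_def runs_replicate)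
qed

text \<open>The vector omits the rise after the last horizontal step. It is 0 because a Dyck word
  ends with a down-step; for \<open>n = 0\<close> there is no such rise.\<close>

lemma mset_mrise_vector:
  assumes "m \<ge> 1" "ballot_path m n B"
  shows "mset (ballot_runs B) = mset (mrise_vector m n B) + (if n = 0 then {#} else {#0#})"
proof -
  have nm: "count_list B Horiz = n * m" using assms(2) by (simp add: ballot_path_def)
  have eq: "ballot_runs B = mrises B # map (mrise B) [1..<n * m + 1]"
    using map_drop_nth_step[of initial_verts Horiz B]
    by (simp add: ballot_runs_def mrises_def mrise_def[abs_def] nm)
  show ?thesis
  proof (cases "n = 0")
    case True
    then show ?thesis by (simp add: eq mrise_vector_def)
  next
    case False
    then have "[1..<n * m + 1] = [1..<n * m] @ [n * m]" using assms(1) by simp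
    then have split: "ballot_runs B = mrise_vector m n B @ [mrise B (n * m)]"
      using eq by (simp add: mrise_vector_def)
    obtain T where "DD m B = dyck_word T" using ballot_path_tree[OF assms(2)] .
    then have "last (map ((*) m) (ballot_runs B)) = 0"
      using last_runs_dyck_word[of T] runs_DD[of m B] by simp
    then have "mrise B (n * m) = 0" using split assms(1) by simp
    with split False show ?thesis by simp
  qed
qed

section \<open>Contacts of a ballot path as arches of its Dyck word\<close>

fun arch_count :: "nat \<Rightarrow> dyck_step list \<Rightarrow> nat" where
  "arch_count h [] = 0"
| "arch_count h (Up # w) = (if h = 0 then 1 else 0) + arch_count (Suc h) w"
| "arch_count 0 (Down # w) = 0"
| "arch_count (Suc h) (Down # w) = arch_count h w"

text \<open>The number of non-final contacts with the line at height \<open>0\<close> of the maximal portion weakly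
  above it, for a path starting at height \<open>h\<close>, where a vertical step has height \<open>m\<close> and a
  horizontal step has height \<open>-1\<close>.\<close>
fun ballot_contacts :: "nat \<Rightarrow> nat \<Rightarrow> ballot_step list \<Rightarrow> nat" where
  "ballot_contacts m h [] = 0"
| "ballot_contacts m h (Vert # B) = (if h = 0 then 1 else 0) + ballot_contacts m (h + m) B"
| "ballot_contacts m 0 (Horiz # B) = 0"
| "ballot_contacts m (Suc h) (Horiz # B) = ballot_contacts m h B"

lemma arch_count_replicate:
  "arch_count h (replicate j Up @ w) = (if h = 0 \<and> 0 < j then 1 else 0) + arch_count (h + j) w"
  by (induction j arbitrary: h) auto

lemma arch_count_DD:
  assumes "m \<ge> 1"
  shows "arch_count h (DD m B) = ballot_contacts m h B"
  using assms
  by (induction m h B rule: ballot_contacts.induct) (auto simp: arch_count_replicate)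

lemma arch_count_dyck_word:
  "arch_count h (dyck_word T @ w) = (if h = 0 then arches T else 0) + arch_count h w"
  by (induction T arbitrary: h w) auto

text \<open>With heights measured from the end of the up-step, the first fall below 0 is its
  matching down-step, so the enclosed arches are counted.\<close>

fun up_contacts :: "dyck_step list \<Rightarrow> nat list" where
  "up_contacts [] = []"
| "up_contacts (Up # w) = arch_count 0 w # up_contacts w"
| "up_contacts (Down # w) = up_contacts w"

lemma up_contacts_dyck_word: "up_contacts (dyck_word T @ w) = degrees T @ up_contacts w"
  by (induction T arbitrary: w) (auto simp: arch_count_dyck_word)

text \<open>The heights \<open>m - 1\<close>, ..., 0 belong to the lines with \<open>j = 1\<close>,
  ..., \<open>m\<close>.\<close>

fun vert_contacts :: "nat \<Rightarrow> ballot_step list \<Rightarrow> nat list" where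
  "vert_contacts m [] = []"
| "vert_contacts m (Vert # B) = map (\<lambda>h. ballot_contacts m h B) (rev [0..<m]) @ vert_contacts m B"
| "vert_contacts m (Horiz # B) = vert_contacts m B"

fun expand_list :: "nat \<Rightarrow> nat \<Rightarrow> nat list \<Rightarrow> nat list" where
  "expand_list m k [] = []"
| "expand_list m k (x # xs) =
     (if m dvd Suc k then m * x else m * (x - 1)) # expand_list m (Suc k) xs"

lemma expand_list_append:
  "expand_list m k (xs @ ys) = expand_list m k xs @ expand_list m (k + length xs) ys"
  by (induction xs arbitrary: k) auto

lemma inorder_expand_at: "inorder (expand_at m k G) = expand_list m k (inorder G)"
  by (induction G arbitrary: k) (auto simp: expand_list_append)

text \<open>This explains the subtraction in the expansion: in a block of \<open>m\<close> up-steps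
  all but the last enclose the arch opened by the next one, and this arch is not a contact of the
  portion after the vertical step.\<close>

lemma expand_list_up_contacts_replicate:
  "i \<le> m \<Longrightarrow> m dvd k + i \<Longrightarrow>
   expand_list m k (up_contacts (replicate i Up @ w)) =
     map (\<lambda>h. m * arch_count h w) (rev [0..<i]) @ expand_list m (k + i) (up_contacts w)"
proof (induction i arbitrary: k)
  case (Suc i)
  have "m dvd Suc k \<longleftrightarrow> i = 0"
  proof
    assume "m dvd Suc k"
    with Suc.prems(2) have "m dvd i" by (simp add: dvd_add_right_iff flip: add_Suc)
    with Suc.prems(1) show "i = 0" by (auto dest: dvd_imp_le)
  qed (use Suc.prems in simp)
  with Suc.IH[of "Suc k"] Suc.prems show ?case
    by (auto simp: arch_count_replicate)
qed simp

lemma expand_list_up_contacts_DD: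
  assumes "m \<ge> 1"
  shows "m dvd k \<Longrightarrow> expand_list m k (up_contacts (DD m B)) = map ((*) m) (vert_contacts m B)"
proof (induction B arbitrary: k)
  case (Cons s B)
  then show ?case
    by (cases s) (auto simp: expand_list_up_contacts_replicate arch_count_DD[OF assms])
qed simp

fun excursion :: "nat \<Rightarrow> nat \<Rightarrow> ballot_step list \<Rightarrow> nat" where
  "excursion m h [] = 0"
| "excursion m h (Vert # B) = Suc (excursion m (h + m) B)"
| "excursion m 0 (Horiz # B) = 0"
| "excursion m (Suc h) (Horiz # B) = Suc (excursion m h B)"

lemma excursion_iff:
  "T \<le> excursion m h B \<longleftrightarrow>
     T \<le> length B \<and> (\<forall>t \<le> T. xpos B t \<le> h + m * ypos B t)"
proof (induction m h B arbitrary: T rule: excursion.induct)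
  case (2 m h B)
  then show ?case by (cases T) (auto simp: all_le_Suc_conv add_ac)
next
  case (3 m B)
  then show ?case by (cases T) (auto simp: all_le_Suc_conv)
next
  case (4 m h B)
  then show ?case by (cases T) (auto simp: all_le_Suc_conv)
qed auto

lemma card_less_Suc_split:
  "card {t. t < Suc e \<and> P t} = (if P 0 then 1 else 0) + card {t. t < e \<and> P (Suc t)}"
proof -
  have "{t. t < Suc e \<and> P t} = (if P 0 then {0} else {}) \<union> Suc ` {t. t < e \<and> P (Suc t)}"
    by (auto simp: image_iff less_Suc_eq_0_disj)
  then show ?thesis by (auto simp: card_image card_insert_if)
qed

lemma ballot_contacts_eq_card:
  "ballot_contacts m h B = card {t. t < excursion m h B \<and> xpos B t = h + m * ypos B t}"
proof (induction m h B rule: ballot_contacts.induct)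
  case (2 m h B)
  then show ?case by (auto simp: card_less_Suc_split add_ac)
next
  case (4 m h B)
  then show ?case by (simp add: card_less_Suc_split)
qed auto

lemma mcontacts_eq_ballot_contacts:
  assumes "ballot_path m n B"
  shows "mcontacts m B = ballot_contacts m 0 B"
proof -
  have "length B \<le> excursion m 0 B"
    using assms by (simp add: excursion_iff ballot_path_def)
  moreover have "excursion m 0 B \<le> length B" using excursion_iff[of "excursion m 0 B" m 0 B] by simp
  ultimately show ?thesis by (simp add: mcontacts_def ballot_contacts_eq_card)
qed

lemma pos_after_nth:
  assumes "k < length B" "B ! k = Vert"
  shows "xpos B (k + 1 + t) = xpos B k + xpos (drop (k + 1) B) t"
    and "ypos B (k + 1 + t) = ypos B k + 1 + ypos (drop (k + 1) B) t"
proof -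
  have "take (k + 1 + t) B = take k B @ Vert # take t (drop (k + 1) B)"
    using assms take_add[of "k + 1" t B] by (simp add: take_Suc_conv_app_nth)
  then show "xpos B (k + 1 + t) = xpos B k + xpos (drop (k + 1) B) t"
    "ypos B (k + 1 + t) = ypos B k + 1 + ypos (drop (k + 1) B) t"
    by (simp_all add: xpos_def ypos_def)
qed

lemma nth_step_props:
  assumes "1 \<le> i" "i \<le> count_list B s"
  shows "nth_step s B i < length B" "B ! nth_step s B i = s"
proof -
  have "length (filter (\<lambda>k. B ! k = s) [0..<length B]) = count_list B s"
    using length_suffixes_after[of s B] by (simp add: suffixes_after_eq)
  with assms have "nth_step s B i \<in> set (filter (\<lambda>k. B ! k = s) [0..<length B])"
    unfolding nth_step_def by (intro nth_mem) simp
  then show "nth_step s B i < length B" "B ! nth_step s B i = s" by auto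
qed

text \<open>If a vertical step has height \<open>m\<close>, its end lies \<open>m - j\<close> above
  the line through the point at height \<open>j\<close> of that step. The maximal portion becomes
  the excursion from there.\<close>

lemma mcontact_eq_ballot_contacts:
  assumes "1 \<le> i" "i \<le> count_list B Vert" "j \<le> m"
  shows "mcontact m B i j = ballot_contacts m (m - j) (drop (nth_step Vert B i + 1) B)"
proof -
  define k where "k = nth_step Vert B i"
  define W where "W = drop (k + 1) B"
  define e where "e = excursion m (m - j) W"
  have k: "k < length B" "B ! k = Vert" using nth_step_props[OF assms(1,2)] by (simp_all add: k_def)
  note pos = pos_after_nth[OF k, folded W_def]
  have le: "xpos B (k + 1 + t) + j + m * ypos B k \<le> m * ypos B (k + 1 + t) + xpos B k \<longleftrightarrow>
      xpos W t \<le> m - j + m * ypos W t" for t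
    unfolding pos using assms(3) by (auto simp: algebra_simps)
  have eq: "xpos B (k + 1 + t) + j + m * ypos B k = m * ypos B (k + 1 + t) + xpos B k \<longleftrightarrow>
      xpos W t = m - j + m * ypos W t" for t
    unfolding pos using assms(3) by (auto simp: algebra_simps)
  have len: "length B = k + 1 + length W" using k by (simp add: W_def)
  have set: "k + 1 \<le> K \<and> K \<le> length B \<and>
      (\<forall>s \<in> {k + 1..K}. xpos B s + j + m * ypos B k \<le> m * ypos B s + xpos B k) \<longleftrightarrow>
      k + 1 \<le> K \<and> K \<le> k + 1 + e" for K
  proof (cases "k + 1 \<le> K")
    case True
    then obtain T where T: "K = k + 1 + T" using le_Suc_ex by blast
    have "(\<forall>s \<in> {k + 1..K}. xpos B s + j + m * ypos B k \<le> m * ypos B s + xpos B k) \<longleftrightarrow>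
        (\<forall>t \<le> T. xpos W t \<le> m - j + m * ypos W t)"
    proof -
      have "{k + 1..K} = (+) (k + 1) ` {0..T}" unfolding T image_add_atLeastAtMost by simp
      then show ?thesis using le by auto
    qed
    then show ?thesis using len T excursion_iff[of T m "m - j" W] by (simp add: e_def)
  qed simp
  have "Max {K. k + 1 \<le> K \<and> K \<le> length B \<and>
      (\<forall>s \<in> {k + 1..K}. xpos B s + j + m * ypos B k \<le> m * ypos B s + xpos B k)} = k + 1 + e"
    unfolding set by (rule Max_eqI) auto
  then have "mcontact m B i j =
      card {s. k + 1 \<le> s \<and> s < k + 1 + e \<and> xpos B s + j + m * ypos B k = m * ypos B s + xpos B k}"
    by (simp add: mcontact_def Let_def k_def)
  also have "{s. k + 1 \<le> s \<and> s < k + 1 + e \<and> xpos B s + j + m * ypos B k = m * ypos B s + xpos B k} =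
      (+) (k + 1) ` {t. t < e \<and> xpos W t = m - j + m * ypos W t}" (is "?A = ?f ` ?C")
  proof (intro set_eqI iffI)
    fix s assume s: "s \<in> ?A"
    then obtain t where "s = k + 1 + t" using le_Suc_ex by blast
    with s eq[of t] show "s \<in> ?f ` ?C" by simp
  next
    fix s assume "s \<in> ?f ` ?C"
    then obtain t where "s = k + 1 + t" "t \<in> ?C" by blast
    with eq[of t] show "s \<in> ?A" by simp
  qed
  also have "card \<dots> = ballot_contacts m (m - j) W"
    unfolding ballot_contacts_eq_card e_def by (intro card_image inj_onI) simp
  finally show ?thesis by (simp add: W_def k_def)
qed

lemma vert_contacts_eq_concat:
  "vert_contacts m B =
     concat (map (\<lambda>W. map (\<lambda>j. ballot_contacts m (m - j) W) [1..<m + 1]) (suffixes_after Vert B))"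
proof (induction B)
  case (Cons s B)
  have "rev [0..<m] = map (\<lambda>j. m - j) [1..<m + 1]"
    by (rule nth_equalityI) (auto simp: rev_nth simp del: upt_Suc)
  with Cons show ?case by (cases s) (simp_all add: comp_def del: upt_Suc)
qed simp

text \<open>The last line for the last vertical step passes through the end of that step. Only
  horizontal steps follow, so the portion is a single point, and its contact is final and not
  counted.\<close>

lemma last_vert_contacts:
  assumes "m \<ge> 1"
  shows "Vert \<in> set B \<Longrightarrow> vert_contacts m B \<noteq> [] \<and> last (vert_contacts m B) = 0"
proof (induction B)
  case (Cons s B)
  obtain p where p: "m = Suc p" using assms by (cases m) auto
  show ?case
  proof (cases "Vert \<in> set B")
    case True
    with Cons.IH show ?thesis by (cases s) auto
  next
    case False
    then have "s = Vert" using Cons.prems by auto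
    have "vert_contacts m B = []" using False
    proof (induction B)
      case (Cons s B)
      then show ?case by (cases s) auto
    qed simp
    moreover have "ballot_contacts m 0 B = 0"
    proof (cases B)
      case (Cons s' B')
      with False show ?thesis by (cases s') auto
    qed simp
    moreover have "last (rev [0..<m]) = 0" using p by (simp add: last_rev hd_upt del: upt_Suc)
    ultimately show ?thesis using p \<open>s = Vert\<close> by (simp add: last_map del: upt_Suc)
  qed
qed simp

lemma mset_mcontact_vector:
  assumes "m \<ge> 1" "ballot_path m n B"
  shows "add_mset (mcontacts m B) (mset (vert_contacts m B)) =
    mset (mcontact_vector m n B) + (if n = 0 then {#} else {#0#})"
proof -
  have n: "count_list B Vert = n" using assms(2) by (simp add: ballot_path_def)
  let ?row = "\<lambda>i. map (\<lambda>j. mcontact m B i j) [1..<m + 1]"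
  let ?guarded = "\<lambda>i. concat (map (\<lambda>j. if (i, j) \<noteq> (n, m) then [mcontact m B i j] else []) [1..<m + 1])"
  have "vert_contacts m B =
      concat (map (\<lambda>i. map (\<lambda>j. ballot_contacts m (m - j) (drop (nth_step Vert B i + 1) B)) [1..<m + 1])
        [1..<n + 1])"
    unfolding vert_contacts_eq_concat n[symmetric]
    by (subst map_drop_nth_step[where f = "\<lambda>W. map (\<lambda>j. ballot_contacts m (m - j) W) [1..<m + 1]"])
      (rule refl)
  also have "\<dots> = concat (map ?row [1..<n + 1])"
    by (intro arg_cong[of _ _ concat] map_cong refl)
      (auto simp: mcontact_eq_ballot_contacts n simp del: upt_Suc)
  finally have rows: "vert_contacts m B = concat (map ?row [1..<n + 1])" .
  have vec: "mcontact_vector m n B = mcontacts m B # concat (map ?guarded [1..<n + 1])"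
    by (simp add: mcontact_vector_def del: upt_Suc)
  show ?thesis
  proof (cases "n = 0")
    case True
    then show ?thesis unfolding rows vec by simp
  next
    case False
    have m1: "[1..<m + 1] = [1..<m] @ [m]" and n1: "[1..<n + 1] = [1..<n] @ [n]"
      using assms(1) False by simp_all
    have "concat (map ?guarded [1..<n]) = concat (map ?row [1..<n])"
    proof (intro arg_cong[of _ _ concat] map_cong refl)
      fix i assume "i \<in> set [1..<n]"
      then show "?guarded i = ?row i" by (simp add: concat_map_singleton del: upt_Suc)
    qed
    moreover have "?guarded n @ [mcontact m B n m] = ?row n"
    proof -
      have "concat (map (\<lambda>j. if (n, j) \<noteq> (n, m) then [mcontact m B n j] else []) [1..<m]) =
          concat (map (\<lambda>j. [mcontact m B n j]) [1..<m])"
        by (intro arg_cong[of _ _ concat] map_cong) auto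
      then show ?thesis unfolding m1 by (simp add: concat_map_singleton)
    qed
    ultimately have split: "concat (map ?guarded [1..<n + 1]) @ [mcontact m B n m] = vert_contacts m B"
      unfolding rows n1 by (simp del: upt_Suc)
    have "Vert \<in> set B" using n False by (metis count_notin)
    then have "last (vert_contacts m B) = 0" using last_vert_contacts[OF assms(1)] by blast
    then have "mcontact m B n m = 0" unfolding split[symmetric] by (simp only: last_snoc)
    then have "mset (vert_contacts m B) = add_mset 0 (mset (concat (map ?guarded [1..<n + 1])))"
      unfolding split[symmetric] mset_append by (simp del: upt_Suc)
    then show ?thesis using False by (simp add: vec del: upt_Suc)
  qed
qed

theorem theorem5p18:
  fixes m n :: nat
  assumes "m \<ge> 1"
  shows "\<forall>I \<in> mtam_intervals m n.
           beta_m m n I \<in> mtam_intervals m n \<and>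
           beta_m m n (beta_m m n I) = I \<and>
           mrises (snd I) = mcontacts m (fst (beta_m m n I)) \<and>
           (\<forall>X :: nat \<Rightarrow> 'a::comm_monoid_mult.
              mRiseMon m n (snd I) X = mContactMon m n (fst (beta_m m n I)) X) \<and>
           mtam_dist m n I = mtam_dist m n (beta_m m n I)"
proof (intro ballI)
  fix I assume "I \<in> mtam_intervals m n"
  then obtain G where G: "encodes m n G I" using mtam_interval_encoded by blast
  define J where "J = beta_m m n I"
  define H where "H = mbeta_tree m G"
  have H: "encodes m n H J" using encodes_beta_m[OF assms G] by (simp add: H_def J_def)
  have mG: "mgrafting_tree m n G" using G by (simp add: encodes_def)
  have mH: "mgrafting_tree m n H" and DD_J: "DD m (fst J) = dyck_word (lower_tree H)"
    and DD_I: "DD m (snd I) = dyck_word (shape G)"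
    using G H by (simp_all add: encodes_def)
  have "mbeta_tree m H = G" using mbeta_tree(3)[OF assms mG] by (simp add: H_def)
  then have inv: "beta_m m n J = I"
    using encodes_beta_m[OF assms H] encodes_inject[OF assms _ G] by simp
  have dist: "mtam_dist m n I = mtam_dist m n J"
    using mtam_dist_encoded[OF assms G] mtam_dist_encoded[OF assms H] mbeta_tree(4)[OF assms mG]
    by (simp add: H_def)
  have ballots: "ballot_path m n (snd I)" "ballot_path m n (fst J)"
    using G H by (auto simp: encodes_def mtam_intervals_def mtam_le_def)

  define E where "E = expand_tree m G"
  have gE: "grafting_tree E" using mgrafting_tree_expand(1)[OF assms mG] by (simp add: E_def)
  have F: "beta_tree E = expand_tree m H"
    using mbeta_tree(2)[OF assms mG] by (simp add: E_def H_def)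
  have runs: "runs (dyck_word (shape E)) = map ((*) m) (ballot_runs (snd I))"
    using runs_DD[of m "snd I"] DD_I by (simp add: E_def expand_tree_def)
  have "arch_count 0 (DD m (fst J)) = arches (lower_tree H)"
    using arch_count_dyck_word[of 0 "lower_tree H" "[]"] DD_J by simp
  then have arches: "arches (lower_tree (beta_tree E)) = m * mcontacts m (fst J)"
    using mgrafting_tree_expand(2)[OF assms mH]
    by (simp add: F arch_count_DD[OF assms] mcontacts_eq_ballot_contacts[OF ballots(2)])
  have "inorder H = up_contacts (DD m (fst J))"
    using up_contacts_dyck_word[of "lower_tree H" "[]"] DD_J mH
    by (simp add: inorder_eq_degrees_lower_tree mgrafting_tree_def)
  then have labels: "inorder (beta_tree E) = map ((*) m) (vert_contacts m (fst J))"
    by (simp add: F expand_tree_def inorder_expand_at expand_list_up_contacts_DD[OF assms])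
  have "m * mrises (snd I) = m * mcontacts m (fst J)"
    using runs_eq_labels_beta_tree(1)[OF gE] by (simp add: runs arches ballot_runs_def mrises_def)
  then have rises: "mrises (snd I) = mcontacts m (fst J)" using assms by simp
  have "image_mset ((*) m) (mset (ballot_runs (snd I))) =
      image_mset ((*) m) (add_mset (mcontacts m (fst J)) (mset (vert_contacts m (fst J))))"
    using runs_eq_labels_beta_tree(2)[OF gE] by (simp add: runs arches labels)
  moreover have "image_mset (\<lambda>x. x div m) (image_mset ((*) m) M) = M" for M
    using assms by (simp add: image_mset.compositionality comp_def)
  ultimately have "mset (ballot_runs (snd I)) =
      add_mset (mcontacts m (fst J)) (mset (vert_contacts m (fst J)))"
    by metis
  \<comment> \<open>The surplus 0 occurs on both sides under the same condition on \<open>n\<close>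
    and cancels.\<close>
  then have vec: "mset (mrise_vector m n (snd I)) = mset (mcontact_vector m n (fst J))"
    using mset_mrise_vector[OF assms ballots(1)] mset_mcontact_vector[OF assms ballots(2)] by simp
  have "mRiseMon m n (snd I) X = mContactMon m n (fst J) X" for X :: "nat \<Rightarrow> 'a"
    unfolding mRiseMon_def mContactMon_def prod_mset_prod_list[symmetric] mset_map vec ..
  with inv dist rises H show "beta_m m n I \<in> mtam_intervals m n \<and>
           beta_m m n (beta_m m n I) = I \<and>
           mrises (snd I) = mcontacts m (fst (beta_m m n I)) \<and>
           (\<forall>X :: nat \<Rightarrow> 'a.
              mRiseMon m n (snd I) X = mContactMon m n (fst (beta_m m n I)) X) \<and>
           mtam_dist m n I = mtam_dist m n (beta_m m n I)"
    by (simp add: J_def encodes_def)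
qed

end
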